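(* Let $G$ be a finite connected graph of genus $g\geq 2$. If $G$ is biconnected, then for a very general choice of edge lengths $\ell:E(G)\to\mathbb{R}_{>0}$, the metric graph $\Gamma=(G,\ell)$ satisfies the Manin--Mumford condition.
   Context: Graphs may have multiple edges. The genus of a connected graph is $\#E(G)-\#V(G)+1$. A graph $G$ of genus $\ge 2$ is biconnected if it is connected, has no loop edges, and remains connected after deleting any vertex. A metric graph $\Gamma=(G,\ell)$ is the compact connected metric space obtained from $G$ and $\ell:E(G)\to\mathbb{R}_{>0}$ by identifying each edge $e$ with a closed interval $[0,\ell(e)]$ and taking the path metric; $(G,\ell)$ is then called a model of $\Gamma$ (a metric graph has many models). $\mathrm{Div}(\Gamma)$ is the free abelian group on the points of $\Gamma$, $\deg$ is the sum of coefficients, and $\mathrm{Div}^0(\Gamma)=\ker(\deg)$. $\mathrm{PL}_{\mathbb{Z}}(\Gamma)$ is the set of continuous functions $f:\Gamma\to\mathbb{R}$ that are linear with integer slope (with respect to arc length) on each edge of some model of $\Gamma$. For such $f$, $\Delta(f)=-\sum_{x\in\Gamma}a_x\,x$, where $a_x$ is the sum of the outgoing slopes of $f$ at $x$. The Jacobian is $\mathrm{Jac}(\Gamma)=\mathrm{Div}^0(\Gamma)/\Delta(\mathrm{PL}_{\mathbb{Z}}(\Gamma))$, and $\mathrm{Jac}(\Gamma)_{\mathrm{tors}}$ is its torsion subgroup. The Abel--Jacobi map with basepoint $q\in\Gamma$ is $\iota_q:\Gamma\to\mathrm{Jac}(\Gamma)$, $\iota_q(x)=[x-q]$. $\Gamma$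 satisfies the Manin--Mumford condition if $\iota_q(\Gamma)\cap\mathrm{Jac}(\Gamma)_{\mathrm{tors}}$ is finite for every $q\in\Gamma$. A property holds for very general edge lengths if there is a countable family of nonzero polynomials $f_i\in\mathbb{R}[x_e: e\in E(G)]$ such that the property holds for every $\ell\in(\mathbb{R}_{>0})^{E(G)}$ with $f_i(\ell)\neq 0$ for all $i$. *)

theory Defs
  imports
    "HOL-Analysis.Analysis"
    "HOL-Algebra.Free_Abelian_Groups"
    "Graph_Theory.Digraph_Component"
begin

section \<open>Multigraphs\<close>

text \<open>
  A finite multigraph (loops and parallel edges allowed) is represented by a \<^locale>\<open>fin_digraph\<close>,
  whose arcs are the edges, each with an arbitrarily chosen orientation.
  \<^const>\<open>Digraph_Component.connected\<close> ignores the orientation (and excludes the empty graph).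
\<close>

definition genus :: "('v, 'e) pre_digraph \<Rightarrow> int" where
  "genus G = int (card (arcs G)) - int (card (verts G)) + 1"

definition biconnected :: "('v, 'e) pre_digraph \<Rightarrow> bool" where
  "biconnected G \<longleftrightarrow>
     Digraph_Component.connected G \<and> loopfree_digraph G \<and>
     (\<forall>v \<in> verts G. Digraph_Component.connected (pre_digraph.del_vert G v))"

section \<open>Metric graphs\<close>

text \<open>
  The points of the metric graph are canonical representatives of the quotient of the disjoint union
  of the intervals \<open>[0, len e]\<close> and the vertices: a vertex, or an edge with a parameter strictly
  between \<open>0\<close> and \<open>len e\<close>. The map \<open>edge_pt G len e\<close> is the quotient map on \<open>[0, len e]\<close>.
\<close>

datatype ('v, 'e) point = Vertex 'v | Inner 'e real

definition edge_pt :: "('v, 'e) pre_digraph \<Rightarrow> ('e \<Rightarrow> real) \<Rightarrow> 'e \<Rightarrow> real \<Rightarrow> ('v, 'e) point" where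
  "edge_pt G len e t =
     (if t \<le> 0 then Vertex (tail G e) else if t \<ge> len e then Vertex (head G e) else Inner e t)"

definition points :: "('v, 'e) pre_digraph \<Rightarrow> ('e \<Rightarrow> real) \<Rightarrow> ('v, 'e) point set" where
  "points G len = Vertex ` verts G \<union> {Inner e t | e t. e \<in> arcs G \<and> 0 < t \<and> t < len e}"

text \<open>
  \<open>path_length G len x y r\<close>: there is a path from \<open>x\<close> to \<open>y\<close> of length \<open>r\<close>, composed of
  finitely many segments, each running inside one closed edge. The value \<open>0\<close> of \<open>path_dist\<close> outside
  \<open>points G len\<close> is a dummy; \<^locale>\<open>Metric_space\<close> requires nonnegativity there as well.
\<close>

inductive path_length ::
    "('v, 'e) pre_digraph \<Rightarrow> ('e \<Rightarrow> real) \<Rightarrow> ('v, 'e) point \<Rightarrow> ('v, 'e) point \<Rightarrow> real \<Rightarrow> bool"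
  for G len where
  path_refl: "x \<in> points G len \<Longrightarrow> path_length G len x x 0"
| path_step: "path_length G len x (edge_pt G len e s) r \<Longrightarrow> e \<in> arcs G \<Longrightarrow>
    s \<in> {0..len e} \<Longrightarrow> t \<in> {0..len e} \<Longrightarrow>
    path_length G len x (edge_pt G len e t) (r + \<bar>t - s\<bar>)"

definition path_dist ::
    "('v, 'e) pre_digraph \<Rightarrow> ('e \<Rightarrow> real) \<Rightarrow> ('v, 'e) point \<Rightarrow> ('v, 'e) point \<Rightarrow> real" where
  "path_dist G len x y =
     (if x \<in> points G len \<and> y \<in> points G len then Inf {r. path_length G len x y r} else 0)"

lemma edge_pt_in_points:
  assumes "wf_digraph G" "e \<in> arcs G"
  shows "edge_pt G len e t \<in> points G len"
  using assms by (auto simp: edge_pt_def points_def wf_digraph_def)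

lemma path_length_nonneg: "path_length G len x y r \<Longrightarrow> 0 \<le> r"
  by (induction rule: path_length.induct) auto

lemma path_length_in: assumes "wf_digraph G" shows "path_length G len x y r \<Longrightarrow> x \<in> points G len \<and> y \<in> points G len"
  by (induction rule: path_length.induct) (auto intro: edge_pt_in_points assms)

lemma path_length_trans:
  assumes "path_length G len y z s" "path_length G len x y r"
  shows "path_length G len x z (r + s)"
  using assms
proof (induction arbitrary: r rule: path_length.induct)
  case (path_refl y) then show ?case by simp
next
  case (path_step y e a s t)
  from path_length.path_step[OF path_step.IH[OF path_step.prems] path_step.hyps(2-4)]
  show ?case by (simp add: add.assoc)
qed

lemma path_length_sym:
  assumes "wf_digraph G" "path_length G len x y r"
  shows "path_length G len y x r"
  using assms(2)
proof (induction rule: path_length.induct)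
  case (path_refl x) then show ?case by (rule path_length.path_refl)
next
  case (path_step x e s r t)
  have "path_length G len (edge_pt G len e t) (edge_pt G len e s) (0 + \<bar>s - t\<bar>)"
    by (intro path_length.path_step path_length.path_refl edge_pt_in_points assms path_step)
  from path_length_trans[OF path_step.IH this] show ?case by (simp add: abs_minus_commute algebra_simps)
qed

lemma path_length_lipschitz:
  fixes h :: "('v,'e) point \<Rightarrow> real"
  assumes "\<And>e s t. e \<in> arcs G \<Longrightarrow> s \<in> {0..len e} \<Longrightarrow> t \<in> {0..len e} \<Longrightarrow>
     \<bar>h (edge_pt G len e t) - h (edge_pt G len e s)\<bar> \<le> \<bar>t - s\<bar>"
  shows "path_length G len x y r \<Longrightarrow> \<bar>h y - h x\<bar> \<le> r"
  by (induction rule: path_length.induct) (auto, smt (verit) assms atLeastAtMost_iff)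

lemma path_length_vertices_reach:
  assumes "wf_digraph G" and pos: "\<forall>e\<in>arcs G. 0 < len e"
    and "(u, v) \<in> rtrancl_on (verts G) (arcs_ends (with_proj (mk_symmetric G)))"
  shows "\<exists>r. path_length G len (Vertex u) (Vertex v) r"
  using assms(3)
proof (induction rule: rtrancl_on.induct)
  case (rtrancl_on_refl a) then show ?case by (auto intro!: exI path_length.path_refl simp: points_def)
next
  case (rtrancl_on_into_rtrancl_on u v w)
  from rtrancl_on_into_rtrancl_on.IH obtain r where r: "path_length G len (Vertex u) (Vertex v) r" by blast
  from rtrancl_on_into_rtrancl_on.hyps(2) obtain e where e: "e \<in> arcs G"
    "(v = tail G e \<and> w = head G e) \<or> (v = head G e \<and> w = tail G e)"
    by (auto simp: mk_symmetric_def arcs_ends_def arc_to_ends_def)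
  have a: "edge_pt G len e 0 = Vertex (tail G e)" "edge_pt G len e (len e) = Vertex (head G e)"
    using pos e(1) by (auto simp: edge_pt_def)
  show ?case using e(2)
      path_step[of G len "Vertex u" e 0 r "len e"] path_step[of G len "Vertex u" e "len e" r 0]
      r a e(1) pos by (metis atLeastAtMost_iff less_eq_real_def)
qed

lemma path_length_to_vertex:
  assumes "wf_digraph G" and pos: "\<forall>e\<in>arcs G. 0 < len e" and x: "x \<in> points G len"
  shows "\<exists>v\<in>verts G. \<exists>r. path_length G len (Vertex v) x r"
proof (cases x)
  case (Vertex v)
  then show ?thesis using x path_refl[OF x] by (auto simp: points_def)
next
  case (Inner e t)
  then have e: "e \<in> arcs G" "0 < t" "t < len e" using x by (auto simp: points_def)
  have "path_length G len (edge_pt G len e 0) (edge_pt G len e t) (0 + \<bar>t - 0\<bar>)"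
    using e by (intro path_step path_refl edge_pt_in_points assms) auto
  moreover have "edge_pt G len e t = x" "edge_pt G len e 0 = Vertex (tail G e)"
    using e Inner by (auto simp: edge_pt_def)
  ultimately show ?thesis using e(1) assms(1) by (auto simp: wf_digraph_def)
qed

lemma path_length_ex:
  assumes w: "wf_digraph G" and con: "Digraph_Component.connected G"
    and pos: "\<forall>e\<in>arcs G. 0 < len e" and x: "x \<in> points G len" and y: "y \<in> points G len"
  shows "\<exists>r. path_length G len x y r"
proof -
  obtain u a where u: "u \<in> verts G" "path_length G len (Vertex u) x a" using path_length_to_vertex[OF w pos x] by auto
  obtain v b where v: "v \<in> verts G" "path_length G len (Vertex v) y b" using path_length_to_vertex[OF w pos y] by auto
  have "(u, v) \<in> rtrancl_on (verts G) (arcs_ends (with_proj (mk_symmetric G)))"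
    using con u v by (auto simp: Digraph_Component.connected_def strongly_connected_def reachable_def mk_symmetric_def)
  then obtain c where c: "path_length G len (Vertex u) (Vertex v) c" using path_length_vertices_reach[OF w pos] by blast
  show ?thesis using path_length_trans[OF path_length_trans[OF v(2) c] path_length_sym[OF w u(2)]] by blast
qed

lemma path_length_separated:
  assumes fd: "fin_digraph G" and pos: "\<forall>e\<in>arcs G. 0 < len e"
    and x: "x \<in> points G len" and y: "y \<in> points G len" and ne: "x \<noteq> y"
  shows "\<exists>d>0. \<forall>r. path_length G len x y r \<longrightarrow> d \<le> r"
proof -
  interpret fin_digraph G by fact
  have inner: "\<exists>d>0. \<forall>r. path_length G len x y r \<longrightarrow> d \<le> r"
    if x: "x \<in> points G len" and "x = Inner e t" "x \<noteq> y" for x y e t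
  proof -
    have e: "e \<in> arcs G" "0 < t" "t < len e" using that by (auto simp: points_def)
    define d where "d = min t (len e - t)"
    define h where "h = (\<lambda>z::('a,'b) point. case z of Vertex _ \<Rightarrow> d | Inner e' s \<Rightarrow> if e' = e then min d \<bar>s - t\<bar> else d)"
    have he: "h (edge_pt G len e' s) = (if e' = e then min d \<bar>s - t\<bar> else d)" if "s \<in> {0..len e'}" for e' s
      using that e by (auto simp: h_def edge_pt_def d_def)
    have L: "\<bar>h y - h x\<bar> \<le> r" if "path_length G len x y r" for r
      by (rule path_length_lipschitz[OF _ that]) (auto simp: he)
    have "h x = 0" "h y > 0" using that e by (auto simp: h_def d_def split: point.splits)
    then show ?thesis using L by (intro exI[of _ "h y"]) fastforce
  qed
  show ?thesis
  proof (cases x)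
    case (Inner e t) then show ?thesis using inner[OF x] ne by blast
  next
    case V: (Vertex v)
    show ?thesis
    proof (cases y)
      case (Inner e t) then show ?thesis using inner[OF y] ne path_length_sym[OF wf_digraph] by metis
    next
      case (Vertex w)
      define d where "d = Min (insert 1 (len ` arcs G))"
      have d0: "d > 0" using pos by (auto simp: d_def)
      have dl: "d \<le> len e" if "e \<in> arcs G" for e using that by (auto simp: d_def)
      define h where "h = (\<lambda>z::('a,'b) point. case z of Vertex u \<Rightarrow> if u = v then 0 else d
        | Inner e s \<Rightarrow> min d (min (if tail G e = v then s else d) (if head G e = v then len e - s else d)))"
      have he: "h (edge_pt G len e s) = min d (min (if tail G e = v then s else d) (if head G e = v then len e - s else d))"
        if "e \<in> arcs G" "s \<in> {0..len e}" for e s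
        using that dl[OF that(1)] d0 by (auto simp: h_def edge_pt_def)
      have L: "\<bar>h y - h x\<bar> \<le> r" if "path_length G len x y r" for r
        by (rule path_length_lipschitz[OF _ that]) (auto simp: he)
      have "h x = 0" "h y = d" using V Vertex ne by (auto simp: h_def)
      then show ?thesis using L d0 by (intro exI[of _ d]) fastforce
    qed
  qed
qed

lemma Metric_space_path_dist:
  assumes fd: "fin_digraph G" and con: "Digraph_Component.connected G"
    and pos: "\<forall>e\<in>arcs G. 0 < len e"
  shows "Metric_space (points G len) (path_dist G len)"
proof -
  interpret fin_digraph G by fact
  have bb: "bdd_below {r. path_length G len x y r}" for x y
    by (auto intro!: bdd_belowI[of _ 0] path_length_nonneg)
  have pd: "path_dist G len x y = Inf {r. path_length G len x y r}"
    if "x \<in> points G len" "y \<in> points G len" for x y using that by (simp add: path_dist_def)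
  have nn: "0 \<le> path_dist G len x y" for x y
  proof (cases "x \<in> points G len \<and> y \<in> points G len")
    case True
    then show ?thesis
      using path_length_ex[OF wf_digraph con pos] by (auto simp: pd intro!: cInf_greatest intro: path_length_nonneg)
  qed (auto simp: path_dist_def)
  have z: "path_dist G len x y = 0 \<longleftrightarrow> x = y" if xy: "x \<in> points G len" "y \<in> points G len" for x y
  proof
    assume "path_dist G len x y = 0"
    show "x = y"
    proof (rule ccontr)
      assume "x \<noteq> y"
      then obtain d where d: "d > 0" "\<And>r. path_length G len x y r \<Longrightarrow> d \<le> r"
        using path_length_separated[OF fd pos xy] by blast
      have "d \<le> path_dist G len x y"
        unfolding pd[OF xy] using path_length_ex[OF wf_digraph con pos xy] by (intro cInf_greatest) (auto intro: d)
      then show False using d \<open>path_dist G len x y = 0\<close> by simp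
    qed
  next
    assume "x = y"
    then show "path_dist G len x y = 0"
      using nn[of x y] cInf_lower[OF _ bb, of 0 x x] path_refl[OF xy(1)] xy pd[OF xy] by force
  qed
  have sy: "path_dist G len x y = path_dist G len y x" for x y
    using path_length_sym[OF wf_digraph] unfolding path_dist_def by (auto intro!: arg_cong[of _ _ Inf])
  have tr: "path_dist G len x z \<le> path_dist G len x y + path_dist G len y z"
    if "x \<in> points G len" "y \<in> points G len" "z \<in> points G len" for x y z
  proof -
    have 1: "path_dist G len x z - r \<le> s" if "path_length G len x y r" "path_length G len y z s" for r s
      using cInf_lower[OF _ bb, of "r + s" x z] path_length_trans[OF that(2,1)] by (simp add: pd \<open>x \<in> _\<close> \<open>z \<in> _\<close>)
    have 2: "path_dist G len x z - r \<le> path_dist G len y z" if "path_length G len x y r" for r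
      unfolding pd[OF \<open>y \<in> _\<close> \<open>z \<in> _\<close>] using path_length_ex[OF wf_digraph con pos, of y z] \<open>y \<in> _\<close> \<open>z \<in> _\<close> 1[OF that]
      by (intro cInf_greatest) auto
    have "path_dist G len x z - path_dist G len y z \<le> r" if "path_length G len x y r" for r
      using 2[OF that] by simp
    then have "path_dist G len x z - path_dist G len y z \<le> path_dist G len x y"
      unfolding pd[OF \<open>x \<in> _\<close> \<open>y \<in> _\<close>] using path_length_ex[OF wf_digraph con pos, of x y] \<open>y \<in> _\<close> \<open>x \<in> _\<close>
      by (intro cInf_greatest) auto
    then show ?thesis by simp
  qed
  show ?thesis
    by unfold_locales (use nn sy z tr in auto)
qed

definition mg_topology :: "('v, 'e) pre_digraph \<Rightarrow> ('e \<Rightarrow> real) \<Rightarrow> ('v, 'e) point topology" where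
  "mg_topology G len = Metric_space.mtopology (points G len) (path_dist G len)"

text \<open>
  Models of a metric graph. Every finite graph is isomorphic to one with
  vertices and edges in \<^typ>\<open>nat\<close>, so restricting to such graphs loses no model.
\<close>

definition is_model ::
    "('v, 'e) pre_digraph \<Rightarrow> ('e \<Rightarrow> real) \<Rightarrow> (nat, nat) pre_digraph \<Rightarrow> (nat \<Rightarrow> real) \<Rightarrow>
     ((nat, nat) point \<Rightarrow> ('v, 'e) point) \<Rightarrow> bool" where
  "is_model G len G' len' \<phi> \<longleftrightarrow>
     fin_digraph G' \<and> Digraph_Component.connected G' \<and> (\<forall>e \<in> arcs G'. 0 < len' e) \<and>
     bij_betw \<phi> (points G' len') (points G len) \<and>
     (\<forall>x \<in> points G' len'. \<forall>y \<in> points G' len'.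
        path_dist G len (\<phi> x) (\<phi> y) = path_dist G' len' x y)"

section \<open>Piecewise linear functions, divisors, and the Jacobian\<close>

definition PL_int :: "('v, 'e) pre_digraph \<Rightarrow> ('e \<Rightarrow> real) \<Rightarrow> (('v, 'e) point \<Rightarrow> real) set" where
  "PL_int G len =
     {f. continuous_map (mg_topology G len) euclideanreal f \<and>
         (\<exists>G' len' \<phi>. is_model G len G' len' \<phi> \<and>
            (\<forall>e \<in> arcs G'. \<exists>(k::int) c. \<forall>t \<in> {0..len' e}.
               f (\<phi> (edge_pt G' len' e t)) = c + of_int k * t))}"

text \<open>
  A tangent direction at \<open>x\<close> is a triple \<open>(e, t, \<sigma>)\<close>: leave \<open>x\<close>, the point with parameter \<open>t\<close>
  on \<open>e\<close>, along \<open>e\<close> in the direction of increasing (\<open>\<sigma> = 1\<close>) or decreasing (\<open>\<sigma> = -1\<close>) parameter.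
  A loop edge contributes two directions at its vertex.
\<close>

definition tangents ::
    "('v, 'e) pre_digraph \<Rightarrow> ('e \<Rightarrow> real) \<Rightarrow> ('v, 'e) point \<Rightarrow> ('e \<times> real \<times> real) set" where
  "tangents G len x =
     {(e, t, \<sigma>). e \<in> arcs G \<and> edge_pt G len e t = x \<and>
        (\<sigma> = 1 \<and> 0 \<le> t \<and> t < len e \<or> \<sigma> = -1 \<and> 0 < t \<and> t \<le> len e)}"

definition outgoing_slope ::
    "('v, 'e) pre_digraph \<Rightarrow> ('e \<Rightarrow> real) \<Rightarrow> (('v, 'e) point \<Rightarrow> real) \<Rightarrow> 'e \<times> real \<times> real \<Rightarrow> real" where
  "outgoing_slope G len f = (\<lambda>(e, t, \<sigma>).
     Lim (at_right 0) (\<lambda>h. (f (edge_pt G len e (t + \<sigma> * h)) - f (edge_pt G len e t)) / h))"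

definition slope_sum ::
    "('v, 'e) pre_digraph \<Rightarrow> ('e \<Rightarrow> real) \<Rightarrow> (('v, 'e) point \<Rightarrow> real) \<Rightarrow> ('v, 'e) point \<Rightarrow> real" where
  "slope_sum G len f x = (\<Sum>\<tau> \<in> tangents G len x. outgoing_slope G len f \<tau>)"

definition Div :: "('v, 'e) pre_digraph \<Rightarrow> ('e \<Rightarrow> real) \<Rightarrow> (('v, 'e) point \<Rightarrow>\<^sub>0 int) monoid" where
  "Div G len = free_Abelian_group (points G len)"

definition deg :: "('a \<Rightarrow>\<^sub>0 int) \<Rightarrow> int" where
  "deg D = (\<Sum>x \<in> Poly_Mapping.keys D. Poly_Mapping.lookup D x)"

definition Div0 :: "('v, 'e) pre_digraph \<Rightarrow> ('e \<Rightarrow> real) \<Rightarrow> (('v, 'e) point \<Rightarrow>\<^sub>0 int) monoid" where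
  "Div0 G len = (Div G len)\<lparr>carrier := kernel (Div G len) integer_group deg\<rparr>"

text \<open>
  For \<open>f \<in> PL_int G len\<close> the sum of outgoing slopes is an integer at every point (the floor only
  converts its type) and vanishes at all but finitely many points.
\<close>

definition Laplacian ::
    "('v, 'e) pre_digraph \<Rightarrow> ('e \<Rightarrow> real) \<Rightarrow> (('v, 'e) point \<Rightarrow> real) \<Rightarrow> (('v, 'e) point \<Rightarrow>\<^sub>0 int)" where
  "Laplacian G len f =
     - (\<Sum>x \<in> {x \<in> points G len. slope_sum G len f x \<noteq> 0}. frag_cmul \<lfloor>slope_sum G len f x\<rfloor> (frag_of x))"

definition principal :: "('v, 'e) pre_digraph \<Rightarrow> ('e \<Rightarrow> real) \<Rightarrow> (('v, 'e) point \<Rightarrow>\<^sub>0 int) set" where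
  "principal G len = Laplacian G len ` PL_int G len"

definition Jac :: "('v, 'e) pre_digraph \<Rightarrow> ('e \<Rightarrow> real) \<Rightarrow> (('v, 'e) point \<Rightarrow>\<^sub>0 int) set monoid" where
  "Jac G len = Div0 G len Mod principal G len"

definition torsion :: "('a, 'b) monoid_scheme \<Rightarrow> 'a set" where
  "torsion A = {a \<in> carrier A. \<exists>n::nat. n > 0 \<and> a [^]\<^bsub>A\<^esub> n = \<one>\<^bsub>A\<^esub>}"

definition abel_jacobi ::
    "('v, 'e) pre_digraph \<Rightarrow> ('e \<Rightarrow> real) \<Rightarrow> ('v, 'e) point \<Rightarrow> ('v, 'e) point \<Rightarrow>
     (('v, 'e) point \<Rightarrow>\<^sub>0 int) set" where
  "abel_jacobi G len q x = principal G len #>\<^bsub>Div0 G len\<^esub> (frag_of x - frag_of q)"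

definition manin_mumford :: "('v, 'e) pre_digraph \<Rightarrow> ('e \<Rightarrow> real) \<Rightarrow> bool" where
  "manin_mumford G len \<longleftrightarrow>
     (\<forall>q \<in> points G len. finite (abel_jacobi G len q ` points G len \<inter> torsion (Jac G len)))"

section \<open>Very general edge lengths\<close>

text \<open>
  A real polynomial in variables \<open>x\<^sub>e\<close> is an element of the monoid algebra
  \<^typ>\<open>('e \<Rightarrow>\<^sub>0 nat) \<Rightarrow>\<^sub>0 real\<close>: finitely many exponent vectors with coefficients.
\<close>

definition poly_vars :: "(('e \<Rightarrow>\<^sub>0 nat) \<Rightarrow>\<^sub>0 real) \<Rightarrow> 'e set" where
  "poly_vars p = (\<Union>m \<in> Poly_Mapping.keys p. Poly_Mapping.keys m)"

definition poly_eval :: "(('e \<Rightarrow>\<^sub>0 nat) \<Rightarrow>\<^sub>0 real) \<Rightarrow> ('e \<Rightarrow> real) \<Rightarrow> real" where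
  "poly_eval p len = (\<Sum>m \<in> Poly_Mapping.keys p.
     Poly_Mapping.lookup p m * (\<Prod>e \<in> Poly_Mapping.keys m. len e ^ Poly_Mapping.lookup m e))"

definition very_general_lengths :: "('v, 'e) pre_digraph \<Rightarrow> (('e \<Rightarrow> real) \<Rightarrow> bool) \<Rightarrow> bool" where
  "very_general_lengths G P \<longleftrightarrow>
     (\<exists>F. countable F \<and> (\<forall>p \<in> F. p \<noteq> 0 \<and> poly_vars p \<subseteq> arcs G) \<and>
        (\<forall>len. (\<forall>e \<in> arcs G. 0 < len e) \<and> (\<forall>p \<in> F. poly_eval p len \<noteq> 0) \<longrightarrow> P len))"

end

theory Submission
  imports Defs
begin

text \<open>
  Choose edge lengths that are linearly independent over \<open>\<rat>\<close>. It suffices that an edge \<open>e\<close> contains no two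
  points \<open>x \<noteq> y\<close> in its interior whose difference is torsion, for then every torsion packet has at most
  one point in the interior of each edge. If \<open>n (x - y)\<close> is the Laplacian of \<open>f\<close>, then the slopes of \<open>f\<close>
  form an integral flow \<open>k\<close> on \<open>G\<close>, where \<open>k e\<close> is the slope of \<open>f\<close> on \<open>e\<close> outside of the segment between
  \<open>x\<close> and \<open>y\<close>. On the edges \<open>a \<noteq> e\<close> the difference of \<open>f\<close> along \<open>a\<close> is \<open>k a\<close> times the length of \<open>a\<close>.

  Independence of the lengths and conservation of the flow imply that two edges which carry flow never
  leave from the same level of \<open>f\<close>. Hence, by biconnectedness, if some \<open>a \<noteq> e\<close> carries flow, then
  all edges do, so \<open>G\<close> has at most as many edges as vertices, contradicting genus at least \<open>2\<close>.
  Thus \<open>k = 0\<close>, and \<open>f\<close> takes the same value at both ends of \<open>e\<close>. But the change of \<open>f\<close> along \<open>e\<close> is then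
  \<open>n\<close> times the distance from \<open>x\<close> to \<open>y\<close> within \<open>e\<close>, up to sign, whence \<open>n = 0\<close>.
\<close>

section \<open>Rationally independent lengths and integral flows\<close>

lemma common_denominator:
  fixes u :: "'a \<Rightarrow> rat"
  assumes "finite S"
  shows "\<exists>d::int. d > 0 \<and> (\<forall>x\<in>S. \<exists>n::int. of_int d * u x = of_int n)"
  using assms
proof induction
  case empty
  show ?case by (intro exI[of _ 1]) auto
next
  case (insert y S)
  then obtain d where d: "d > 0" "\<And>x. x \<in> S \<Longrightarrow> \<exists>n::int. of_int d * u x = of_int n" by blast
  obtain p q where q: "u y = of_int p / of_int q" "q > 0"
    by (metis quotient_of_div quotient_of_denom_pos surj_pair)
  show ?case
  proof (rule exI[of _ "d * q"], intro conjI ballI)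
    fix x assume x: "x \<in> insert y S"
    show "\<exists>n::int. of_int (d * q) * u x = of_int n"
    proof (cases "x = y")
      case True
      then show ?thesis using q by (intro exI[of _ "d * p"]) simp
    next
      case False
      then obtain n where "of_int d * u x = of_int n" using d x by blast
      then show ?thesis by (intro exI[of _ "q * n"]) (simp add: algebra_simps)
    qed
  qed (use d q in simp)
qed

text \<open>Clearing denominators turns integral independence into linear independence in the reals
  as a rational vector space. The coordinate of \<open>l a\<close> extends linearly to all reals, so
  it applies to arbitrary values of a potential.\<close>

lemma coordinate_functional:
  fixes l :: "'e \<Rightarrow> real"
  assumes fin: "finite E" and a: "a \<in> E"
    and indep: "\<And>m::'e \<Rightarrow> int. (\<Sum>b\<in>E. of_int (m b) * l b) = 0 \<Longrightarrow> (\<forall>b\<in>E. m b = 0)"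
  shows "\<exists>\<phi>::real \<Rightarrow> rat. (\<forall>x y. \<phi> (x - y) = \<phi> x - \<phi> y) \<and>
           (\<forall>b\<in>E. \<forall>n::int. \<phi> (of_int n * l b) = (if b = a then of_int n else 0))"
proof -
  interpret V: vector_space_pair "\<lambda>q x. of_rat q * x :: real" "(*) :: rat \<Rightarrow> rat \<Rightarrow> rat"
    by unfold_locales (auto simp: algebra_simps of_rat_add of_rat_mult)
  have inj: "inj_on l E"
  proof (rule inj_onI, rule ccontr)
    fix b c assume bc: "b \<in> E" "c \<in> E" "l b = l c" "b \<noteq> c"
    define m :: "'e \<Rightarrow> int" where "m = (\<lambda>x. if x = b then 1 else if x = c then -1 else 0)"
    have "(\<Sum>x\<in>E. of_int (m x) * l x) = (\<Sum>x\<in>{b, c}. of_int (m x) * l x)"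
      using fin bc by (intro sum.mono_neutral_right) (auto simp: m_def)
    also have "\<dots> = 0" using bc by (simp add: m_def)
    finally have "m b = 0" using indep bc by blast
    then show False by (simp add: m_def)
  qed
  have ind: "V.vs1.independent (l ` E)"
    unfolding V.vs1.dependent_explicit
  proof (clarify)
    fix T u v assume T: "finite T" "T \<subseteq> l ` E" "(\<Sum>v\<in>T. of_rat (u v) * v) = 0" "v \<in> T" "u v \<noteq> 0"
    define w where "w = (\<lambda>b. if l b \<in> T then u (l b) else 0)"
    obtain d n where d: "d > 0" and n: "\<And>b. b \<in> E \<Longrightarrow> of_int d * w b = of_int (n b)"
      using common_denominator[OF fin, of w] by metis
    have "(\<Sum>b\<in>E. of_int (n b) * l b) = (\<Sum>b\<in>E. of_rat (of_int d * w b) * l b)"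
      by (intro sum.cong refl) (simp add: n)
    also have "\<dots> = of_int d * (\<Sum>b\<in>E. of_rat (w b) * l b)"
      by (simp add: of_rat_mult sum_distrib_left mult.assoc)
    also have "(\<Sum>b\<in>E. of_rat (w b) * l b) = (\<Sum>x\<in>l ` E. of_rat (if x \<in> T then u x else 0) * x)"
      by (simp add: sum.reindex[OF inj] w_def)
    also have "\<dots> = (\<Sum>x\<in>T. of_rat (u x) * x)"
      using T fin by (intro sum.mono_neutral_cong_right) auto
    finally have "\<forall>b\<in>E. n b = 0" using indep T by simp
    moreover obtain b where b: "b \<in> E" "v = l b" using T by blast
    ultimately have "of_int d * w b = 0" using n by force
    then show False using T b d by (simp add: w_def)
  qed
  obtain \<phi> where lin: "Vector_Spaces.linear (\<lambda>q x. of_rat q * x :: real) (*) \<phi>"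
    and \<phi>: "\<forall>x\<in>l ` E. \<phi> x = (if x = l a then 1 else 0)"
    using V.linear_independent_extend[OF ind, of "\<lambda>x. if x = l a then 1 else 0"] by blast
  interpret \<phi>: Vector_Spaces.linear "\<lambda>q x. of_rat q * x :: real" "(*) :: rat \<Rightarrow> rat \<Rightarrow> rat" \<phi> by (rule lin)
  have "\<phi> (of_int n * l b) = (if b = a then of_int n else 0)" if "b \<in> E" for b n
    using \<phi>.scale[of "of_int n" "l b"] \<phi> that inj a by (auto simp: inj_on_eq_iff)
  then show ?thesis using \<phi>.diff by blast
qed

section \<open>Connectedness and conserved integral flows\<close>

lemma connected_induct:
  assumes con: "Digraph_Component.connected H" and u: "u \<in> verts H" "v \<in> verts H" and P: "P u"
    and step: "\<And>a. a \<in> arcs H \<Longrightarrow> P (tail H a) \<longleftrightarrow> P (head H a)"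
  shows "P v"
proof -
  have "(u, v) \<in> rtrancl_on (verts H) (arcs_ends (with_proj (mk_symmetric H)))"
    using con u by (auto simp: Digraph_Component.connected_def strongly_connected_def reachable_def mk_symmetric_def)
  then show ?thesis using P
  proof (induction rule: rtrancl_on.induct)
    case (rtrancl_on_into_rtrancl_on u v w)
    from rtrancl_on_into_rtrancl_on.hyps(2) obtain a where "a \<in> arcs H"
      "(v = tail H a \<and> w = head H a) \<or> (v = head H a \<and> w = tail H a)"
      by (auto simp: mk_symmetric_def arcs_ends_def arc_to_ends_def)
    then show ?case using rtrancl_on_into_rtrancl_on.IH rtrancl_on_into_rtrancl_on.prems step by blast
  qed
qed

text \<open>
  Away from \<open>e\<close>, the flow \<open>k\<close> is the gradient of the potential \<open>f\<close>. On \<open>e\<close> itself \<open>k\<close> and \<open>f\<close>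
  are unrelated, since there the piecewise linear function bends at the two torsion points.
\<close>

locale resonant_flow = fin_digraph G for G :: "('v, 'e) pre_digraph" +
  fixes len :: "'e \<Rightarrow> real" and f :: "'v \<Rightarrow> real" and k :: "'e \<Rightarrow> int" and e :: 'e
  assumes len_pos: "a \<in> arcs G \<Longrightarrow> 0 < len a"
    and len_indep: "(\<Sum>a\<in>arcs G. of_int (m a) * len a) = 0 \<Longrightarrow> a \<in> arcs G \<Longrightarrow> m a = (0::int)"
    and e_arc: "e \<in> arcs G"
    and potential: "a \<in> arcs G \<Longrightarrow> a \<noteq> e \<Longrightarrow> f (head G a) - f (tail G a) = of_int (k a) * len a"
    and conserved: "v \<in> verts G \<Longrightarrow> (\<Sum>a\<in>in_arcs G v. k a) = (\<Sum>a\<in>out_arcs G v. k a)"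
    and biconn: "biconnected G"
    and genus_ge_2: "2 \<le> genus G"
begin

text \<open>Summation by parts: grouped by vertices, the coefficient of \<open>h v\<close> is inflow
  minus outflow. For the indicator \<open>h\<close> of a vertex set, the net flow into that set is
  zero.\<close>

lemma flow_orthogonal:
  fixes h :: "'v \<Rightarrow> int"
  shows "(\<Sum>a\<in>arcs G. k a * (h (head G a) - h (tail G a))) = 0"
proof -
  have "(\<Sum>a\<in>arcs G. k a * h (head G a)) = (\<Sum>v\<in>verts G. \<Sum>a\<in>in_arcs G v. k a * h (head G a))"
    unfolding in_arcs_def by (rule sum.group[symmetric]) auto
  also have "\<dots> = (\<Sum>v\<in>verts G. h v * (\<Sum>a\<in>in_arcs G v. k a))"
    by (intro sum.cong refl) (simp add: in_arcs_def sum_distrib_left mult.commute)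
  also have "\<dots> = (\<Sum>v\<in>verts G. h v * (\<Sum>a\<in>out_arcs G v. k a))"
    by (intro sum.cong refl) (simp add: conserved)
  also have "\<dots> = (\<Sum>v\<in>verts G. \<Sum>a\<in>out_arcs G v. k a * h (tail G a))"
    by (intro sum.cong refl) (simp add: out_arcs_def sum_distrib_left mult.commute)
  also have "\<dots> = (\<Sum>a\<in>arcs G. k a * h (tail G a))"
    unfolding out_arcs_def by (rule sum.group) auto
  finally show ?thesis by (simp add: right_diff_distrib sum_subtractf)
qed

lemma arcs_not_loop: "a \<in> arcs G \<Longrightarrow> tail G a \<noteq> head G a"
  using biconn by (auto simp: biconnected_def dest: loopfree_digraph.no_loops)

text \<open>
  The end of \<open>a\<close> at which the flow enters the edge; if \<open>a \<noteq> e\<close> carries flow, this is the end where \<open>f\<close>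
  is lower. For \<open>k a = 0\<close> the value is meaningless.
\<close>

definition lo :: "'e \<Rightarrow> 'v" where
  "lo a = (if 0 < k a then tail G a else head G a)"

text \<open>Flow that enters the edge outside the set indicated by \<open>h\<close> can only cross
  into that set, never out of it.\<close>

lemma flow_term_nonneg:
  fixes h :: "'v \<Rightarrow> int"
  assumes "h (lo a) = 0" "h (tail G a) \<in> {0, 1}" "h (head G a) \<in> {0, 1}"
  shows "k a * (h (head G a) - h (tail G a)) \<ge> 0"
  using assms by (auto simp: lo_def split: if_splits intro: mult_nonneg_nonpos2)

text \<open>
  \<open>Q\<close> is a level set of a \<open>\<rat>\<close>-linear functional that is \<open>1\<close> on the length of \<open>a\<close> and \<open>0\<close> on all other
  lengths. As \<open>Q \<circ> f\<close> changes only along \<open>a\<close> and \<open>e\<close>, these two edges carry the same flow across a cut.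
\<close>

lemma cut_at_arc:
  assumes a: "a \<in> arcs G" "a \<noteq> e" "k a \<noteq> 0"
  shows "k e \<noteq> 0 \<and> (\<exists>Q. Q (f (lo a)) \<and> \<not> Q (f (lo e)) \<and> \<not> (Q (f (head G a)) \<and> Q (f (tail G a))) \<and>
    (\<forall>b\<in>arcs G - {a, e}. Q (f (head G b)) \<longleftrightarrow> Q (f (tail G b))))"
proof -
  have "\<exists>\<phi>::real \<Rightarrow> rat. (\<forall>x y. \<phi> (x - y) = \<phi> x - \<phi> y) \<and>
      (\<forall>b\<in>arcs G. \<forall>n::int. \<phi> (of_int n * len b) = (if b = a then of_int n else 0))"
    by (rule coordinate_functional[OF finite_arcs a(1)]) (use len_indep in blast)
  then obtain \<phi> :: "real \<Rightarrow> rat" where diff: "\<And>x y. \<phi> (x - y) = \<phi> x - \<phi> y"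
    and \<phi>: "\<And>b n. b \<in> arcs G \<Longrightarrow> \<phi> (of_int n * len b) = (if b = a then of_int n else 0)"
    by blast
  have jump: "\<phi> (f (head G b)) - \<phi> (f (tail G b)) = (if b = a then of_int (k b) else 0)"
    if "b \<in> arcs G" "b \<noteq> e" for b
    by (simp add: diff[symmetric] potential[OF that] \<phi>[OF that(1)])
  define Q where "Q = (\<lambda>x. \<phi> x = \<phi> (f (lo a)))"
  define h :: "'v \<Rightarrow> int" where "h = (\<lambda>v. of_bool (Q (f v)))"
  have 1: "Q (f (head G b)) \<longleftrightarrow> Q (f (tail G b))" if "b \<in> arcs G" "b \<noteq> a" "b \<noteq> e" for b
    using jump[of b] that by (simp add: Q_def)
  have 2: "\<not> (Q (f (head G a)) \<and> Q (f (tail G a)))"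
    using jump[of a] a by (auto simp: Q_def)
  have 3: "Q (f (lo a))" by (simp add: Q_def)
  have "(\<Sum>b\<in>arcs G. k b * (h (head G b) - h (tail G b))) = (\<Sum>b\<in>{a, e}. k b * (h (head G b) - h (tail G b)))"
    using a e_arc 1 by (intro sum.mono_neutral_right) (auto simp: h_def)
  then have "k a * (h (head G a) - h (tail G a)) + k e * (h (head G e) - h (tail G e)) = 0"
    using flow_orthogonal[of h] a by simp
  \<comment> \<open>Flow along \<open>a\<close> leaves the level set, so by balance flow along
    \<open>e\<close> enters it, which puts \<open>lo e\<close> outside.\<close>
  moreover have "k a * (h (head G a) - h (tail G a)) < 0"
    using 2 3 a by (auto simp: h_def lo_def split: if_splits)
  ultimately have 4: "k e * (h (head G e) - h (tail G e)) > 0" by linarith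
  then have "\<not> Q (f (lo e))"
    by (auto simp: h_def lo_def zero_less_mult_iff split: if_splits)
  moreover have "k e \<noteq> 0" using 4 by auto
  ultimately show ?thesis using 1 2 3 by blast
qed

text \<open>
  If \<open>a\<close> and \<open>b\<close> leave from the same level of \<open>f\<close>, then flow enters along \<open>b\<close>, and cannot leave, the part
  of the level set \<open>Q\<close> where \<open>f\<close> exceeds \<open>f (lo a)\<close>.
\<close>

lemma inj_on_lo: "inj_on (\<lambda>a. f (lo a)) {a \<in> arcs G. k a \<noteq> 0}"
proof -
  have *: False if a: "a \<in> arcs G" "k a \<noteq> 0" "a \<noteq> e" and b: "b \<in> arcs G" "k b \<noteq> 0" "b \<noteq> a"
    and eq: "f (lo a) = f (lo b)" for a b
  proof -
    obtain Q where Qs: "\<forall>b\<in>arcs G - {a, e}. Q (f (head G b)) \<longleftrightarrow> Q (f (tail G b))"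
      and Q: "Q (f (lo a))" "\<not> Q (f (lo e))" "\<not> (Q (f (head G a)) \<and> Q (f (tail G a)))"
      using cut_at_arc[OF a(1,3,2)] by metis
    have "b \<noteq> e" using Q(1,2) eq by auto
    \<comment> \<open>The strict inequality keeps \<open>lo a\<close> and \<open>lo b\<close>
      outside the set. Off \<open>a\<close> and \<open>e\<close>, flow runs towards larger
      \<open>f\<close> and never leaves the level set.\<close>
    define h :: "'v \<Rightarrow> int" where "h = (\<lambda>v. of_bool (Q (f v) \<and> f (lo a) < f v))"
    have up: "k c > 0 \<and> f (head G c) > f (tail G c) \<or> k c < 0 \<and> f (head G c) < f (tail G c) \<or> k c = 0"
      if "c \<in> arcs G" "c \<noteq> e" for c
    proof -
      have "f (head G c) - f (tail G c) = of_int (k c) * len c" "len c > 0"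
        using that potential len_pos by auto
      then have "k c > 0 \<Longrightarrow> f (head G c) - f (tail G c) > 0" "k c < 0 \<Longrightarrow> f (head G c) - f (tail G c) < 0"
        by (simp_all add: mult_neg_pos)
      then show ?thesis by linarith
    qed
    have nonneg: "k c * (h (head G c) - h (tail G c)) \<ge> 0" if c: "c \<in> arcs G" for c
    proof (cases "c = e \<or> c = a")
      case True
      then have "h (lo c) = 0" using Q by (auto simp: h_def lo_def)
      then show ?thesis by (rule flow_term_nonneg) (auto simp: h_def)
    next
      case False
      then have "k c > 0 \<and> h (head G c) \<ge> h (tail G c) \<or> k c < 0 \<and> h (head G c) \<le> h (tail G c) \<or> k c = 0"
        using up[OF c] Qs c by (auto simp: h_def)
      then show ?thesis by (auto intro: mult_nonneg_nonneg mult_nonpos_nonpos)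
    qed
    \<comment> \<open>Both ends of \<open>b\<close> satisfy \<open>Q\<close>; it starts at height
      \<open>f (lo a)\<close> and climbs, so its flow enters the set.\<close>
    have "k b * (h (head G b) - h (tail G b)) > 0"
      using up[OF b(1) \<open>b \<noteq> e\<close>] Qs b \<open>b \<noteq> e\<close> Q(1) eq
      by (auto simp: h_def lo_def split: if_splits)
    then have "(\<Sum>c\<in>arcs G. k c * (h (head G c) - h (tail G c))) > 0"
      using nonneg b(1) by (intro sum_pos2[of _ b]) auto
    then show False using flow_orthogonal[of h] by simp
  qed
  show ?thesis
  proof (rule inj_onI, rule ccontr)
    fix a b assume ab: "a \<in> {a \<in> arcs G. k a \<noteq> 0}" "b \<in> {a \<in> arcs G. k a \<noteq> 0}"
      "f (lo a) = f (lo b)" "a \<noteq> b"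
    \<comment> \<open>At most one of two distinct edges is \<open>e\<close>; the other can play the
      role of \<open>a\<close>.\<close>
    then show False using *[of a b] *[of b a] by (cases "a = e") auto
  qed
qed

text \<open>Flow that touches \<open>v\<close> must also depart from \<open>v\<close>: otherwise,
  for the indicator of \<open>v\<close>, all terms are nonnegative and that of \<open>a\<close> is
  positive.\<close>

lemma ex_lo:
  assumes a: "a \<in> arcs G" "k a \<noteq> 0" and v: "v = tail G a \<or> v = head G a"
  shows "\<exists>b\<in>arcs G. k b \<noteq> 0 \<and> lo b = v"
proof (rule ccontr)
  assume no: "\<not> ?thesis"
  define h :: "'v \<Rightarrow> int" where "h = (\<lambda>w. of_bool (w = v))"
  have nonneg: "k c * (h (head G c) - h (tail G c)) \<ge> 0" if c: "c \<in> arcs G" for c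
  proof (cases "k c = 0")
    case False
    then have "h (lo c) = 0" using no c by (auto simp: h_def)
    then show ?thesis by (rule flow_term_nonneg) (auto simp: h_def)
  qed simp
  have "lo a \<noteq> v" using no a by blast
  then have "k a * (h (head G a) - h (tail G a)) > 0"
    using v a(2) by (auto simp: h_def lo_def split: if_splits)
  then have "(\<Sum>c\<in>arcs G. k c * (h (head G c) - h (tail G c))) > 0"
    using nonneg a(1) by (intro sum_pos2[of _ a]) auto
  then show False using flow_orthogonal[of h] by simp
qed

text \<open>The form in which connectedness after deleting \<open>w\<close> is used:
  \<open>P\<close> only has to propagate along edges that avoid \<open>w\<close>.\<close>

lemma connected_minus_vertex:
  assumes "w \<in> verts G" "u \<in> verts G - {w}" "v \<in> verts G - {w}" "P u"
    and "\<And>a. a \<in> arcs G \<Longrightarrow> tail G a \<noteq> w \<Longrightarrow> head G a \<noteq> w \<Longrightarrow> P (tail G a) \<longleftrightarrow> P (head G a)"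
  shows "P v"
  by (rule connected_induct[of "del_vert w" u v P])
    (use assms biconn in \<open>auto simp: biconnected_def del_vert_simps\<close>)

text \<open>
  Both ends of \<open>b\<close> lie on one level of \<open>f\<close>, and at most one vertex \<open>w\<close> of that level meets edges with
  nonzero flow. Deleting \<open>w\<close> would disconnect the rest of the level from the other levels.
\<close>

lemma flow_vanishes:
  assumes b: "b \<in> arcs G" "b \<noteq> e" "k b = 0" and a: "a \<in> arcs G" "a \<noteq> e"
  shows "k a = 0"
proof (rule ccontr)
  assume ka: "k a \<noteq> 0"
  have ke: "k e \<noteq> 0" using cut_at_arc[OF a ka] by (rule conjunct1)
  define c where "c = f (tail G b)"
  have c: "f (head G b) = c" using potential[OF b(1,2)] b(3) by (simp add: c_def)
  \<comment> \<open>By \<open>inj_on_lo\<close>, flow departs from at most one vertex of level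
    \<open>c\<close>, and \<open>w\<close> is that vertex. If there is none, any vertex of the level
    serves, here \<open>tail G b\<close>.\<close>
  define w where "w = (if \<exists>a\<in>arcs G. k a \<noteq> 0 \<and> f (lo a) = c
     then lo (SOME a. a \<in> arcs G \<and> k a \<noteq> 0 \<and> f (lo a) = c) else tail G b)"
  have w: "f w = c \<and> w \<in> verts G \<and> (\<forall>a\<in>arcs G. k a \<noteq> 0 \<longrightarrow> f (lo a) = c \<longrightarrow> lo a = w)"
  proof (cases "\<exists>a\<in>arcs G. k a \<noteq> 0 \<and> f (lo a) = c")
    case True
    define a' where "a' = (SOME a. a \<in> arcs G \<and> k a \<noteq> 0 \<and> f (lo a) = c)"
    have a': "a' \<in> arcs G \<and> k a' \<noteq> 0 \<and> f (lo a') = c" unfolding a'_def by (rule someI_ex) (use True in blast)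
    moreover have "w = lo a'" unfolding w_def a'_def using True by (rule if_P)
    moreover have "lo a' \<in> verts G" using a' by (simp add: lo_def)
    moreover have "lo d = lo a'" if "d \<in> arcs G" "k d \<noteq> 0" "f (lo d) = c" for d
      using inj_onD[OF inj_on_lo, of d a'] that a' by simp
    ultimately show ?thesis by blast
  next
    case False
    then show ?thesis using b by (auto simp: w_def c_def)
  qed
  \<comment> \<open>By \<open>ex_lo\<close>, a vertex of the level other than \<open>w\<close>
    touches no flow at all.\<close>
  have zero: "k d = 0" if "d \<in> arcs G" "v = tail G d \<or> v = head G d" "f v = c" "v \<noteq> w" for d v
    using ex_lo[of d v] that w by blast
  \<comment> \<open>\<open>b\<close> is no loop, so one of its ends differs from
    \<open>w\<close>.\<close>
  obtain z where z: "z \<in> verts G - {w}" "f z = c"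
    using b arcs_not_loop[OF b(1)] c c_def by (metis Diff_iff head_in_verts singletonD tail_in_verts)
  have "f v = c" if "v \<in> verts G - {w}" for v
  proof (rule connected_minus_vertex[of w z v "\<lambda>v. f v = c"])
    fix d assume d: "d \<in> arcs G" "tail G d \<noteq> w" "head G d \<noteq> w"
    show "f (tail G d) = c \<longleftrightarrow> f (head G d) = c"
    proof (cases "k d = 0")
      case True
      then have "d \<noteq> e" using ke by blast
      then show ?thesis using potential[OF d(1)] True by simp
    next
      case False
      then show ?thesis using zero[of d] d by blast
    qed
  qed (use z w that in auto)
  then have "f v = c" if "v \<in> verts G" for v using that w by blast
  then show False using potential[OF a] ka len_pos[OF a(1)] a by simp
qed

theorem no_flow: "k e = 0 \<and> f (head G e) = f (tail G e)"
proof -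
  have "2 \<le> card (arcs G)"
  proof -
    have "card (verts G) > 0" using tail_in_verts[OF e_arc] by (auto simp: card_gt_0_iff)
    then show ?thesis using genus_ge_2 by (simp add: genus_def)
  qed
  then obtain b where b: "b \<in> arcs G" "b \<noteq> e"
    by (metis card_le_Suc0_iff_eq finite_arcs not_less_eq_eq numeral_2_eq_2)
  have all0: "k a = 0" if a: "a \<in> arcs G" "a \<noteq> e" for a
  proof (rule ccontr)
    assume ka: "k a \<noteq> 0"
    have ke: "k e \<noteq> 0" using cut_at_arc[OF a ka] by (rule conjunct1)
    have "{a \<in> arcs G. k a \<noteq> 0} = arcs G" using flow_vanishes a ka ke by blast
    then have "card (arcs G) = card ((\<lambda>a. f (lo a)) ` arcs G)"
      using inj_on_lo by (simp add: card_image)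
    also have "\<dots> \<le> card (f ` verts G)" by (intro card_mono) (auto simp: lo_def)
    also have "\<dots> \<le> card (verts G)" by (simp add: card_image_le)
    finally show False using genus_ge_2 by (simp add: genus_def)
  qed
  have "k e = 0"
  proof (rule ccontr)
    assume ke: "k e \<noteq> 0"
    \<comment> \<open>Flow would depart from both ends of \<open>e\<close>, which are distinct, so
      an edge other than \<open>e\<close> would carry flow.\<close>
    then obtain a where "a \<in> arcs G" "k a \<noteq> 0" "lo a \<noteq> lo e"
      using ex_lo[OF e_arc ke, of "tail G e"] ex_lo[OF e_arc ke, of "head G e"] arcs_not_loop[OF e_arc] by metis
    then show False using all0 by blast
  qed
  moreover have "f (head G e) = f (tail G e)"
  proof (rule ccontr)
    assume ne: "f (head G e) \<noteq> f (tail G e)"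
    have same: "f (tail G a) = f (head G a)" if "a \<in> arcs G" "a \<noteq> e" for a
      using potential[OF that] all0[OF that] by simp
    have same': "f (tail G a) = x \<longleftrightarrow> f (head G a) = x"
      if "a \<in> arcs G" "tail G a \<noteq> w" "head G a \<noteq> w" "w = tail G e \<or> w = head G e" for a w x
      using same[of a] that by metis
    \<comment> \<open>Deleting either end of \<open>e\<close> removes \<open>e\<close>, so
      \<open>f\<close> is constant on the rest. A third vertex would get both values; without one,
      \<open>b\<close> joins the two ends of \<open>e\<close> and equates their values.\<close>
    have "f v = f (head G e)" if "v \<in> verts G - {tail G e}" for v
      by (rule connected_minus_vertex[of "tail G e" "head G e" v "\<lambda>v. f v = f (head G e)"])
        (use that e_arc ne arcs_not_loop[OF e_arc] in \<open>auto simp: same'\<close>)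
    moreover have "f v = f (tail G e)" if "v \<in> verts G - {head G e}" for v
      by (rule connected_minus_vertex[of "head G e" "tail G e" v "\<lambda>v. f v = f (tail G e)"])
        (use that e_arc ne arcs_not_loop[OF e_arc] in \<open>auto simp: same'\<close>)
    ultimately have "verts G \<subseteq> {tail G e, head G e}" using ne by fastforce
    then show False using ne same[OF b] arcs_not_loop[OF b(1)] head_in_verts[OF b(1)] tail_in_verts[OF b(1)]
      by (metis insertE singletonD subsetD)
  qed
  ultimately show ?thesis ..
qed

end

section \<open>Piecewise linear functions along edges\<close>

text \<open>For a function with integral slopes this fails just at the bends.\<close>

definition affine_at :: "(real \<Rightarrow> real) \<Rightarrow> real \<Rightarrow> bool" where
  "affine_at F t \<longleftrightarrow> (\<exists>k::int. \<forall>\<^sub>F s in nhds t. F s = F t + of_int k * (s - t))"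

lemma affine_at_combine:
  assumes "affine_at F t" "affine_at F' t"
  shows "affine_at (\<lambda>s. of_int c * F s + of_int d * F' s) t"
proof -
  obtain k k' :: int where "\<forall>\<^sub>F s in nhds t. F s = F t + of_int k * (s - t)"
    "\<forall>\<^sub>F s in nhds t. F' s = F' t + of_int k' * (s - t)" using assms by (auto simp: affine_at_def)
  then have "\<forall>\<^sub>F s in nhds t. of_int c * F s + of_int d * F' s =
      (of_int c * F t + of_int d * F' t) + of_int (c * k + d * k') * (s - t)"
  proof eventually_elim
    case (elim s)
    show ?case unfolding elim by (simp add: algebra_simps)
  qed
  then show ?thesis unfolding affine_at_def by blast
qed

text \<open>The local slope is unique, hence locally constant, hence constant on the open interval;
  continuity carries the formula to the end points.\<close>

lemma affine_on_interval:
  assumes ab: "\<alpha> < \<beta>" and cont: "continuous_on {\<alpha>..\<beta>} F" and aff: "\<And>t. \<alpha> < t \<Longrightarrow> t < \<beta> \<Longrightarrow> affine_at F t"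
  shows "\<exists>k::int. \<forall>s\<in>{\<alpha>..\<beta>}. F s = F \<alpha> + of_int k * (s - \<alpha>)"
proof -
  define K where "K = (\<lambda>t. SOME k::int. \<forall>\<^sub>F s in nhds t. F s = F t + of_int k * (s - t))"
  have K: "\<forall>\<^sub>F s in nhds t. F s = F t + of_int (K t) * (s - t)" if "\<alpha> < t" "t < \<beta>" for t
    using someI_ex[OF aff[OF that, unfolded affine_at_def]] by (simp add: K_def)
  have deriv: "(F has_real_derivative of_int k) (at s)" if "\<forall>\<^sub>F s in nhds s. F s = c + of_int k * (s - t)" for k :: int and s t c
  proof -
    have "((\<lambda>s. c + of_int k * (s - t)) has_real_derivative of_int k) (at s)"
      by (auto intro!: derivative_eq_intros)
    then show ?thesis using DERIV_cong_ev[OF refl that refl] by blast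
  qed
  have K0: "((\<lambda>t. real_of_int (K t)) has_real_derivative 0) (at t)" if t: "\<alpha> < t" "t < \<beta>" for t
  proof -
    have "\<forall>\<^sub>F s in nhds t. \<forall>\<^sub>F r in nhds s. F r = F t + of_int (K t) * (r - t)"
      using K[OF t] by (simp add: eventually_eventually)
    moreover have "\<forall>\<^sub>F s in nhds t. s \<in> {\<alpha><..<\<beta>}" using t by (intro eventually_nhds_in_open) auto
    ultimately have "\<forall>\<^sub>F s in nhds t. real_of_int (K s) = real_of_int (K t)"
    proof eventually_elim
      case (elim s)
      then show ?case using DERIV_unique[OF deriv[OF elim(1)] deriv[OF K]] by simp
    qed
    then show ?thesis using DERIV_cong_ev[OF refl _ refl, of "\<lambda>s. real_of_int (K s)" "\<lambda>_. real_of_int (K t)" t 0] by simp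
  qed
  define k where "k = K ((\<alpha> + \<beta>) / 2)"
  have Kk: "K t = k" if "\<alpha> < t" "t < \<beta>" for t
    using DERIV_isconst3[OF ab, of t "(\<alpha> + \<beta>) / 2" "\<lambda>t. real_of_int (K t)"] K0 that ab by (simp add: k_def)
  have "F s - of_int k * s = F \<alpha> - of_int k * \<alpha>" if "s \<in> {\<alpha>..\<beta>}" for s
  proof (rule DERIV_isconst2[OF ab, of "\<lambda>s. F s - of_int k * s"])
    fix t assume t: "\<alpha> < t" "t < \<beta>"
    show "((\<lambda>s. F s - of_int k * s) has_real_derivative 0) (at t)"
      using deriv[OF K[OF t]] by (auto intro!: derivative_eq_intros simp: Kk[OF t])
  next
    show "continuous_on {\<alpha>..\<beta>} (\<lambda>s. F s - of_int k * s)" by (intro continuous_intros cont)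
  qed (use that in auto)
  then show ?thesis by (intro exI[of _ k] ballI) (auto simp: algebra_simps)
qed

text \<open>The slope is taken in the direction of travel: a function affine with slope
  \<open>k\<close> has slope \<open>-k\<close> for \<open>\<sigma> = -1\<close>. Exact equality near
  \<open>t\<close> replaces the limit.\<close>

definition dir_slope :: "(real \<Rightarrow> real) \<Rightarrow> real \<Rightarrow> real \<Rightarrow> real \<Rightarrow> bool" where
  "dir_slope F t \<sigma> k \<longleftrightarrow> (\<forall>\<^sub>F h in at_right 0. F (t + \<sigma> * h) = F t + k * h)"

lemma dir_slope_Lim:
  assumes "dir_slope F t \<sigma> k"
  shows "Lim (at_right 0) (\<lambda>h. (F (t + \<sigma> * h) - F t) / h) = k"
proof (rule tendsto_Lim)
  have "\<forall>\<^sub>F h in at_right 0. (F (t + \<sigma> * h) - F t) / h = k"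
    using assms[unfolded dir_slope_def] eventually_at_right_less[of "0::real"]
    by eventually_elim simp
  then show "((\<lambda>h. (F (t + \<sigma> * h) - F t) / h) \<longlongrightarrow> k) (at_right 0)" by (rule tendsto_eventually)
qed simp

lemma dir_slope_combine:
  assumes "dir_slope F t \<sigma> k" "dir_slope F' t \<sigma> k'"
  shows "dir_slope (\<lambda>s. c * F s + d * F' s) t \<sigma> (c * k + d * k')"
  using assms unfolding dir_slope_def
proof eventually_elim
  case (elim h)
  show ?case unfolding elim by (simp add: algebra_simps)
qed

lemma dir_slope_right:
  assumes "t < \<beta>" "\<And>s. s \<in> {t..\<beta>} \<Longrightarrow> F s = c + k * s"
  shows "dir_slope F t 1 k"
  unfolding dir_slope_def eventually_at_right_field
  using assms by (intro exI[of _ "\<beta> - t"]) (auto simp: algebra_simps)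

lemma dir_slope_left:
  assumes "\<alpha> < t" "\<And>s. s \<in> {\<alpha>..t} \<Longrightarrow> F s = c + k * s"
  shows "dir_slope F t (-1) (-k)"
  unfolding dir_slope_def eventually_at_right_field
  using assms by (intro exI[of _ "t - \<alpha>"]) (auto simp: algebra_simps)

lemma affine_at_dir_slopes:
  assumes "affine_at F t"
  shows "\<exists>k. dir_slope F t 1 k \<and> dir_slope F t (-1) (-k)"
proof -
  obtain k :: int and d where d: "d > 0" "\<And>s. \<bar>s - t\<bar> < d \<Longrightarrow> F s = F t + of_int k * (s - t)"
    using assms by (auto simp: affine_at_def eventually_nhds_metric dist_real_def)
  have "dir_slope F t 1 (of_int k)" "dir_slope F t (-1) (- of_int k)"
    unfolding dir_slope_def eventually_at_right_field
    by (rule exI[of _ d], use d(1) d(2)[of "t + _"] d(2)[of "t - _"] in simp)+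
  then show ?thesis by blast
qed

lemma affine_atI:
  assumes r: "dir_slope F t 1 k" and l: "dir_slope F t (-1) (-k)" and k: "k \<in> \<int>"
  shows "affine_at F t"
proof -
  obtain d1 where d1: "d1 > 0" "\<And>h. 0 < h \<Longrightarrow> h < d1 \<Longrightarrow> F (t + h) = F t + k * h"
    using r by (auto simp: dir_slope_def eventually_at_right_field)
  obtain d2 where d2: "d2 > 0" "\<And>h. 0 < h \<Longrightarrow> h < d2 \<Longrightarrow> F (t - h) = F t - k * h"
    using l by (auto simp: dir_slope_def eventually_at_right_field)
  obtain m :: int where m: "k = of_int m" using k by (elim Ints_cases)
  have "F s = F t + of_int m * (s - t)" if "\<bar>s - t\<bar> < min d1 d2" for s
    using d1(2)[of "s - t"] d2(2)[of "t - s"] that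
    by (cases s t rule: linorder_cases) (auto simp: m algebra_simps)
  moreover have "0 < min d1 d2" using d1(1) d2(1) by simp
  ultimately show ?thesis unfolding affine_at_def eventually_nhds_metric dist_real_def by blast
qed

text \<open>Refers to the edges of \<open>G\<close> alone, so that two such functions combine
  without a common refinement of their models.\<close>

definition edgewise_PL :: "('v, 'e) pre_digraph \<Rightarrow> ('e \<Rightarrow> real) \<Rightarrow> (('v, 'e) point \<Rightarrow> real) \<Rightarrow> bool" where
  "edgewise_PL G len f \<longleftrightarrow> (\<forall>e\<in>arcs G. continuous_on {0..len e} (\<lambda>t. f (edge_pt G len e t)) \<and>
     finite {t \<in> {0<..<len e}. \<not> affine_at (\<lambda>t. f (edge_pt G len e t)) t})"

lemma edgewise_PL_combine:
  assumes "edgewise_PL G len f" "edgewise_PL G len g"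
  shows "edgewise_PL G len (\<lambda>x. of_int c * f x + of_int d * g x)"
  unfolding edgewise_PL_def
proof (intro ballI conjI)
  fix e assume e: "e \<in> arcs G"
  let ?F = "\<lambda>t. f (edge_pt G len e t)" and ?G = "\<lambda>t. g (edge_pt G len e t)"
  have 1: "continuous_on {0..len e} ?F" "finite {t \<in> {0<..<len e}. \<not> affine_at ?F t}"
    "continuous_on {0..len e} ?G" "finite {t \<in> {0<..<len e}. \<not> affine_at ?G t}"
    using assms e by (auto simp: edgewise_PL_def)
  then show "continuous_on {0..len e} (\<lambda>t. of_int c * ?F t + of_int d * ?G t)"
    by (intro continuous_intros) auto
  show "finite {t \<in> {0<..<len e}. \<not> affine_at (\<lambda>t. of_int c * ?F t + of_int d * ?G t) t}"
    by (rule finite_subset[OF _ finite_UnI[OF 1(2,4)]]) (use affine_at_combine[of ?F _ ?G c d] in auto)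
qed

lemma edgewise_PL_dir_slope:
  assumes PL: "edgewise_PL G len f" and e: "e \<in> arcs G"
    and t: "\<sigma> = 1 \<and> 0 \<le> t \<and> t < len e \<or> \<sigma> = -1 \<and> 0 < t \<and> t \<le> len e"
  shows "\<exists>k::int. dir_slope (\<lambda>t. f (edge_pt G len e t)) t \<sigma> (of_int k)"
proof -
  let ?F = "\<lambda>t. f (edge_pt G len e t)"
  define B where "B = {t \<in> {0<..<len e}. \<not> affine_at ?F t}"
  have cont: "continuous_on {0..len e} ?F" and B: "finite B" using PL e by (auto simp: edgewise_PL_def B_def)
  from t show ?thesis
  proof (elim disjE conjE)
    assume t: "\<sigma> = 1" "0 \<le> t" "t < len e"
    \<comment> \<open>The next bend after \<open>t\<close>, or else the end of the edge: no bend
      lies strictly between.\<close>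
    define \<beta> where "\<beta> = Min (insert (len e) {b \<in> B. t < b})"
    have \<beta>: "t < \<beta>" "\<beta> \<le> len e" "\<And>b. b \<in> B \<Longrightarrow> t < b \<Longrightarrow> \<beta> \<le> b" using B t by (auto simp: \<beta>_def)
    have "\<exists>k::int. \<forall>s\<in>{t..\<beta>}. ?F s = ?F t + of_int k * (s - t)"
    proof (rule affine_on_interval[OF \<beta>(1)])
      show "continuous_on {t..\<beta>} ?F" using continuous_on_subset[OF cont, of "{t..\<beta>}"] t \<beta> by auto
      show "affine_at ?F s" if "t < s" "s < \<beta>" for s using \<beta>(2) \<beta>(3)[of s] that t by (force simp: B_def)
    qed
    then obtain k :: int where k: "\<forall>s\<in>{t..\<beta>}. ?F s = ?F t + of_int k * (s - t)" by blast
    have "?F s = (?F t - of_int k * t) + of_int k * s" if "s \<in> {t..\<beta>}" for s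
      using bspec[OF k that] by (simp add: algebra_simps)
    from dir_slope_right[OF \<beta>(1) this] show ?thesis using t(1) by blast
  next
    assume t: "\<sigma> = -1" "0 < t" "t \<le> len e"
    define \<alpha> where "\<alpha> = Max (insert 0 {b \<in> B. b < t})"
    have \<alpha>: "\<alpha> < t" "0 \<le> \<alpha>" "\<And>b. b \<in> B \<Longrightarrow> b < t \<Longrightarrow> b \<le> \<alpha>" using B t by (auto simp: \<alpha>_def)
    have "\<exists>k::int. \<forall>s\<in>{\<alpha>..t}. ?F s = ?F \<alpha> + of_int k * (s - \<alpha>)"
    proof (rule affine_on_interval[OF \<alpha>(1)])
      show "continuous_on {\<alpha>..t} ?F" using continuous_on_subset[OF cont, of "{\<alpha>..t}"] t \<alpha> by auto
      show "affine_at ?F s" if "\<alpha> < s" "s < t" for s using \<alpha>(2) \<alpha>(3)[of s] that t by (force simp: B_def)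
    qed
    then obtain k :: int where k: "\<forall>s\<in>{\<alpha>..t}. ?F s = ?F \<alpha> + of_int k * (s - \<alpha>)" by blast
    have "?F s = (?F \<alpha> - of_int k * \<alpha>) + of_int k * s" if "s \<in> {\<alpha>..t}" for s
      using bspec[OF k that] by (simp add: algebra_simps)
    from dir_slope_left[OF \<alpha>(1) this] show ?thesis using t(1) by (metis of_int_minus)
  qed
qed

section \<open>Slope sums and coefficients of the Laplacian\<close>

lemma outgoing_slope_eq:
  "dir_slope (\<lambda>t. f (edge_pt G len e t)) t \<sigma> k \<Longrightarrow> outgoing_slope G len f (e, t, \<sigma>) = k"
  unfolding outgoing_slope_def prod.case by (rule dir_slope_Lim)

lemma edgewise_PL_tangent:
  assumes "edgewise_PL G len f" "(e, t, \<sigma>) \<in> tangents G len x"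
  obtains k :: int where "dir_slope (\<lambda>t. f (edge_pt G len e t)) t \<sigma> (of_int k)"
  using edgewise_PL_dir_slope[OF assms(1), of e \<sigma> t] assms(2) by (auto simp: tangents_def)

lemma slope_sum_combine:
  assumes f: "edgewise_PL G len f" and g: "edgewise_PL G len g"
  shows "slope_sum G len (\<lambda>x. c * f x + d * g x) x = c * slope_sum G len f x + d * slope_sum G len g x"
proof -
  have "outgoing_slope G len (\<lambda>x. c * f x + d * g x) \<tau> =
      c * outgoing_slope G len f \<tau> + d * outgoing_slope G len g \<tau>" if tau: "\<tau> \<in> tangents G len x" for \<tau>
  proof -
    obtain e t \<sigma> where \<tau>: "\<tau> = (e, t, \<sigma>)" by (cases \<tau>)
    obtain k :: int where k: "dir_slope (\<lambda>t. f (edge_pt G len e t)) t \<sigma> (of_int k)"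
      by (rule edgewise_PL_tangent[OF f tau[unfolded \<tau>]])
    obtain k' :: int where k': "dir_slope (\<lambda>t. g (edge_pt G len e t)) t \<sigma> (of_int k')"
      by (rule edgewise_PL_tangent[OF g tau[unfolded \<tau>]])
    show ?thesis
      unfolding \<tau> outgoing_slope_eq[of f, OF k] outgoing_slope_eq[of g, OF k']
      by (rule outgoing_slope_eq) (rule dir_slope_combine[OF k k'])
  qed
  then show ?thesis by (simp add: slope_sum_def sum.distrib sum_distrib_left)
qed

lemma slope_sum_in_Ints:
  assumes "edgewise_PL G len f" shows "slope_sum G len f x \<in> \<int>"
  unfolding slope_sum_def
proof (rule Ints_sum)
  fix \<tau> assume tau: "\<tau> \<in> tangents G len x"
  obtain e t \<sigma> where \<tau>: "\<tau> = (e, t, \<sigma>)" by (cases \<tau>)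
  obtain k :: int where k: "dir_slope (\<lambda>t. f (edge_pt G len e t)) t \<sigma> (of_int k)"
    by (rule edgewise_PL_tangent[OF assms tau[unfolded \<tau>]])
  show "outgoing_slope G len f \<tau> \<in> \<int>" unfolding \<tau> outgoing_slope_eq[of f, OF k] by simp
qed

lemma slope_sum_Inner:
  assumes e: "e \<in> arcs G" "0 < t" "t < len e"
    and "dir_slope (\<lambda>t. f (edge_pt G len e t)) t 1 r" "dir_slope (\<lambda>t. f (edge_pt G len e t)) t (-1) l"
  shows "slope_sum G len f (Inner e t) = r + l"
proof -
  have "tangents G len (Inner e t) = {(e, t, 1), (e, t, -1)}"
    using e by (auto simp: tangents_def edge_pt_def split: if_splits)
  then show ?thesis using outgoing_slope_eq[OF assms(4)] outgoing_slope_eq[OF assms(5)] by (simp add: slope_sum_def)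
qed

lemma slope_sum_Vertex:
  assumes fin: "fin_digraph G" and pos: "\<And>a. a \<in> arcs G \<Longrightarrow> 0 < len a"
    and r: "\<And>a. a \<in> out_arcs G v \<Longrightarrow> dir_slope (\<lambda>t. f (edge_pt G len a t)) 0 1 (r a)"
    and l: "\<And>a. a \<in> in_arcs G v \<Longrightarrow> dir_slope (\<lambda>t. f (edge_pt G len a t)) (len a) (-1) (l a)"
  shows "slope_sum G len f (Vertex v) = (\<Sum>a\<in>out_arcs G v. r a) + (\<Sum>a\<in>in_arcs G v. l a)"
proof -
  define O' where "O' = (\<lambda>a. (a, 0::real, 1::real)) ` out_arcs G v"
  define I' where "I' = (\<lambda>a. (a, len a, -1::real)) ` in_arcs G v"
  have T: "tangents G len (Vertex v) = O' \<union> I'"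
    using pos by (force simp: O'_def I'_def tangents_def edge_pt_def out_arcs_def in_arcs_def split: if_splits)
  have "finite O'" "finite I'"
    unfolding O'_def I'_def out_arcs_def in_arcs_def using fin_digraph.finite_arcs[OF fin] by simp_all
  moreover have "O' \<inter> I' = {}" by (auto simp: O'_def I'_def)
  ultimately have "slope_sum G len f (Vertex v) = sum (outgoing_slope G len f) O' + sum (outgoing_slope G len f) I'"
    unfolding slope_sum_def T by (rule sum.union_disjoint)
  also have "sum (outgoing_slope G len f) O' = (\<Sum>a\<in>out_arcs G v. r a)"
    unfolding O'_def by (subst sum.reindex) (auto simp: inj_on_def intro!: sum.cong outgoing_slope_eq r)
  also have "sum (outgoing_slope G len f) I' = (\<Sum>a\<in>in_arcs G v. l a)"
    unfolding I'_def by (subst sum.reindex) (auto simp: inj_on_def intro!: sum.cong outgoing_slope_eq l)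
  finally show ?thesis .
qed

lemma slope_sum_affine:
  assumes "e \<in> arcs G" "0 < t" "t < len e" "affine_at (\<lambda>t. f (edge_pt G len e t)) t"
  shows "slope_sum G len f (Inner e t) = 0"
proof -
  obtain k where "dir_slope (\<lambda>t. f (edge_pt G len e t)) t 1 k" "dir_slope (\<lambda>t. f (edge_pt G len e t)) t (-1) (-k)"
    using affine_at_dir_slopes[OF assms(4)] by blast
  from slope_sum_Inner[OF assms(1-3) this] show ?thesis by simp
qed

text \<open>Slope sums vanish away from the vertices and finitely many bends, so the defining sum is
  finite; they are integers, so the floor changes nothing.\<close>

lemma lookup_Laplacian:
  assumes fin: "fin_digraph G" and PL: "edgewise_PL G len f" and z: "z \<in> points G len"
  shows "of_int (Poly_Mapping.lookup (Laplacian G len f) z) = - slope_sum G len f z"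
proof -
  let ?A = "{x \<in> points G len. slope_sum G len f x \<noteq> 0}"
  let ?B = "\<lambda>e. {t \<in> {0<..<len e}. \<not> affine_at (\<lambda>t. f (edge_pt G len e t)) t}"
  have "?A \<subseteq> Vertex ` verts G \<union> (\<Union>e\<in>arcs G. Inner e ` ?B e)"
  proof
    fix x assume x: "x \<in> ?A"
    show "x \<in> Vertex ` verts G \<union> (\<Union>e\<in>arcs G. Inner e ` ?B e)"
    proof (cases x)
      case (Vertex v)
      then show ?thesis using x by (auto simp: points_def)
    next
      case (Inner e t)
      then have e: "e \<in> arcs G" "0 < t" "t < len e" using x by (auto simp: points_def)
      then have "t \<in> ?B e" using slope_sum_affine[of e G t len f] e x Inner by auto
      then show ?thesis using e(1) Inner by blast
    qed
  qed
  moreover have "finite (Vertex ` verts G \<union> (\<Union>e\<in>arcs G. Inner e ` ?B e))"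
    using PL fin_digraph.finite_verts[OF fin] fin_digraph.finite_arcs[OF fin] by (auto simp: edgewise_PL_def)
  ultimately have A: "finite ?A" by (rule finite_subset)
  have "Poly_Mapping.lookup (Laplacian G len f) z = - (\<Sum>x\<in>?A. \<lfloor>slope_sum G len f x\<rfloor> * (if z = x then 1 else 0))"
    by (simp add: Laplacian_def lookup_sum frag_cmul_def lookup_single when_def)
  also have "\<dots> = - \<lfloor>slope_sum G len f z\<rfloor>"
    using A z by (simp add: if_distrib cong: if_cong)
  finally show ?thesis using slope_sum_in_Ints[OF PL, of z] by (auto elim!: Ints_cases)
qed

section \<open>Metric graphs near interior points of edges\<close>

lemma path_dist_le:
  assumes "wf_digraph G" "path_length G len x y r"
  shows "path_dist G len x y \<le> r"
proof -
  have "bdd_below {r. path_length G len x y r}" by (auto intro!: bdd_belowI[of _ 0] path_length_nonneg)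
  then show ?thesis using assms path_length_in[OF assms] by (auto simp: path_dist_def intro: cInf_lower)
qed

lemma path_dist_ge:
  assumes "wf_digraph G" "Digraph_Component.connected G" "\<forall>e\<in>arcs G. 0 < len e"
    and "x \<in> points G len" "y \<in> points G len" and "\<And>r. path_length G len x y r \<Longrightarrow> d \<le> r"
  shows "d \<le> path_dist G len x y"
  using assms path_length_ex[OF assms(1-5)] by (auto simp: path_dist_def intro!: cInf_greatest)

lemma path_dist_edge_le:
  assumes "wf_digraph G" "e \<in> arcs G" "s \<in> {0..len e}" "t \<in> {0..len e}"
  shows "path_dist G len (edge_pt G len e s) (edge_pt G len e t) \<le> \<bar>t - s\<bar>"
proof -
  have "path_length G len (edge_pt G len e s) (edge_pt G len e t) (0 + \<bar>t - s\<bar>)"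
    by (intro path_step path_refl edge_pt_in_points assms)
  then show ?thesis using path_dist_le[OF assms(1)] by fastforce
qed

text \<open>
  The distance function to an interior point, truncated at the distance to the nearer end of its edge,
  can be read off the edge alone and is 1-Lipschitz.
\<close>

lemma near_Inner:
  assumes w: "wf_digraph G" and con: "Digraph_Component.connected G" and pos: "\<forall>e\<in>arcs G. 0 < len e"
    and x: "Inner e a \<in> points G len" and z: "z \<in> points G len"
    and near: "path_dist G len (Inner e a) z < min a (len e - a)"
  shows "\<exists>s. z = Inner e s \<and> \<bar>s - a\<bar> = path_dist G len (Inner e a) z"
proof -
  have e: "e \<in> arcs G" "0 < a" "a < len e" using x by (auto simp: points_def)
  define d where "d = min a (len e - a)"
  define h where "h = (\<lambda>z::('a,'b) point. case z of Vertex _ \<Rightarrow> d | Inner e' s \<Rightarrow> if e' = e then min d \<bar>s - a\<bar> else d)"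
  have he: "h (edge_pt G len e' s) = (if e' = e then min d \<bar>s - a\<bar> else d)" if "s \<in> {0..len e'}" for e' s
    using that e by (auto simp: h_def edge_pt_def d_def)
  have hx: "h (Inner e a) = 0" using e by (simp add: h_def d_def)
  have "h z \<le> path_dist G len (Inner e a) z"
  proof (rule path_dist_ge[OF w con pos x z])
    fix r assume "path_length G len (Inner e a) z r"
    then have "\<bar>h z - h (Inner e a)\<bar> \<le> r"
      by (rule path_length_lipschitz[rotated]) (auto simp: he)
    then show "h z \<le> r" using hx by simp
  qed
  moreover from this near obtain s where s: "z = Inner e s" "\<bar>s - a\<bar> < d"
    unfolding d_def[symmetric] by (cases z) (auto simp: h_def split: if_splits)
  ultimately have "\<bar>s - a\<bar> \<le> path_dist G len (Inner e a) z" by (simp add: h_def)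
  moreover have "0 < s" "s < len e" using z s(1) by (auto simp: points_def)
  then have "path_dist G len (Inner e a) z \<le> \<bar>s - a\<bar>"
    using path_dist_edge_le[OF w e(1), of a len s] e s(1) by (auto simp: edge_pt_def)
  ultimately show ?thesis using s(1) by force
qed

lemma near_Inner_dist:
  assumes w: "wf_digraph G" and con: "Digraph_Component.connected G" and pos: "\<forall>e\<in>arcs G. 0 < len e"
    and x: "Inner e a \<in> points G len" and z: "Inner e s \<in> points G len" and "\<bar>s - a\<bar> < min a (len e - a)"
  shows "path_dist G len (Inner e a) (Inner e s) = \<bar>s - a\<bar>"
proof -
  have "e \<in> arcs G" "0 < a" "a < len e" "0 < s" "s < len e" using x z by (auto simp: points_def)
  then have "path_dist G len (Inner e a) (Inner e s) \<le> \<bar>s - a\<bar>"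
    using path_dist_edge_le[OF w, of e a len s] by (auto simp: edge_pt_def)
  moreover from this assms(6) obtain s' where "Inner e s = (Inner e s' :: ('a, 'b) point)"
    "\<bar>s' - a\<bar> = path_dist G len (Inner e a) (Inner e s)"
    using near_Inner[OF w con pos x z] by fastforce
  ultimately show ?thesis by simp
qed

section \<open>Comparing an arbitrary model with the edges of \<open>G\<close>\<close>

lemma real_local_isometry:
  fixes u :: "real \<Rightarrow> real"
  assumes "0 < d" and iso: "\<And>s t. \<bar>s - t0\<bar> < d \<Longrightarrow> \<bar>t - t0\<bar> < d \<Longrightarrow> \<bar>u t - u s\<bar> = \<bar>t - s\<bar>"
  shows "\<exists>\<sigma>\<in>{1, -1}. \<forall>t. \<bar>t - t0\<bar> < d \<longrightarrow> u t = u t0 + \<sigma> * (t - t0)"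
proof -
  \<comment> \<open>A second reference point: the distances to the images of \<open>t0\<close> and
    \<open>t1\<close> together determine \<open>u t\<close>.\<close>
  define t1 where "t1 = t0 + d / 2"
  have t1: "\<bar>u t1 - u t0\<bar> = d / 2" using iso[of t0 t1] \<open>0 < d\<close> by (simp add: t1_def)
  define \<sigma> where "\<sigma> = (u t1 - u t0) / (d / 2)"
  have \<sigma>: "\<sigma> \<in> {1, -1}" using t1 \<open>0 < d\<close> by (auto simp: \<sigma>_def abs_if field_simps split: if_splits)
  have "u t = u t0 + \<sigma> * (t - t0)" if t: "\<bar>t - t0\<bar> < d" for t
  proof -
    have "\<bar>u t - u t0\<bar> = \<bar>t - t0\<bar>" "\<bar>u t - u t1\<bar> = \<bar>t - t0 - d / 2\<bar>"
      using iso[of t0 t] iso[of t1 t] t \<open>0 < d\<close> by (auto simp: t1_def algebra_simps)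
    moreover have "u t1 = u t0 + \<sigma> * (d / 2)" using \<open>0 < d\<close> by (simp add: \<sigma>_def field_simps)
    ultimately show ?thesis using \<sigma> \<open>0 < d\<close> by (auto simp: abs_if split: if_splits)
  qed
  then show ?thesis using \<sigma> by blast
qed

text \<open>The model of \<open>f\<close> is tied to \<open>G\<close> only by an isometry
  \<open>\<phi>\<close>. In the model \<open>f\<close> is Lipschitz, hence continuous along the
  edges of \<open>G\<close>. Where the preimage of an interior point is interior to a model edge,
  the isometry is locally a shift or a reflection and \<open>f\<close> does not bend; so bends come
  only from the finitely many model vertices.\<close>

lemma PL_int_edgewise:
  assumes fd: "fin_digraph G" and con: "Digraph_Component.connected G" and pos: "\<forall>e\<in>arcs G. 0 < len e"
    and f: "f \<in> PL_int G len"
  shows "edgewise_PL G len f"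
  unfolding edgewise_PL_def
proof (intro ballI conjI)
  fix e assume e: "e \<in> arcs G"
  have w: "wf_digraph G" using fd by (simp add: fin_digraph_def)
  from f obtain G' len' \<phi> where model: "is_model G len G' len' \<phi>"
    and "\<forall>e \<in> arcs G'. \<exists>(k::int) c. \<forall>t \<in> {0..len' e}. f (\<phi> (edge_pt G' len' e t)) = c + of_int k * t"
    by (auto simp: PL_int_def)
  then obtain k :: "nat \<Rightarrow> int" and c where k: "\<And>e t. e \<in> arcs G' \<Longrightarrow> t \<in> {0..len' e} \<Longrightarrow>
      f (\<phi> (edge_pt G' len' e t)) = c e + of_int (k e) * t" by metis
  have fd': "fin_digraph G'" and con': "Digraph_Component.connected G'" and pos': "\<forall>e\<in>arcs G'. 0 < len' e"
    and bij: "bij_betw \<phi> (points G' len') (points G len)"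
    and iso: "\<And>x y. x \<in> points G' len' \<Longrightarrow> y \<in> points G' len' \<Longrightarrow> path_dist G len (\<phi> x) (\<phi> y) = path_dist G' len' x y"
    using model by (auto simp: is_model_def)
  have w': "wf_digraph G'" using fd' by (simp add: fin_digraph_def)
  define \<psi> where "\<psi> = inv_into (points G' len') \<phi>"
  have \<psi>: "\<psi> x \<in> points G' len'" "\<phi> (\<psi> x) = x" if "x \<in> points G len" for x
    using bij that by (auto simp: \<psi>_def bij_betw_def inv_into_into f_inv_into_f)
  have \<psi>_iso: "path_dist G' len' (\<psi> x) (\<psi> y) = path_dist G len x y" if "x \<in> points G len" "y \<in> points G len" for x y
    using iso[of "\<psi> x" "\<psi> y"] \<psi> that by simp
  let ?F = "\<lambda>t. f (edge_pt G len e t)"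
  \<comment> \<open>The summand 1 keeps the Lipschitz constant positive even if all slopes vanish,
    so that it can be divided by.\<close>
  define K where "K = 1 + (\<Sum>e\<in>arcs G'. \<bar>real_of_int (k e)\<bar>)"
  have K: "K > 0" "\<And>e. e \<in> arcs G' \<Longrightarrow> \<bar>real_of_int (k e)\<bar> \<le> K"
  proof -
    show "K > 0" unfolding K_def by (intro add_pos_nonneg sum_nonneg) auto
    fix e assume "e \<in> arcs G'"
    then have "\<bar>real_of_int (k e)\<bar> \<le> (\<Sum>e\<in>arcs G'. \<bar>real_of_int (k e)\<bar>)"
      using fin_digraph.finite_arcs[OF fd'] by (intro member_le_sum) auto
    then show "\<bar>real_of_int (k e)\<bar> \<le> K" by (simp add: K_def)
  qed
  have lip: "\<bar>f (\<phi> y) - f (\<phi> x)\<bar> \<le> K * path_dist G' len' x y"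
    if xy: "x \<in> points G' len'" "y \<in> points G' len'" for x y
  proof -
    have "\<bar>f (\<phi> y) - f (\<phi> x)\<bar> / K \<le> path_dist G' len' x y"
    proof (rule path_dist_ge[OF w' con' pos' xy])
      fix r assume "path_length G' len' x y r"
      then have "\<bar>f (\<phi> y) / K - f (\<phi> x) / K\<bar> \<le> r"
      proof (rule path_length_lipschitz[rotated])
        fix e s t assume st: "e \<in> arcs G'" "s \<in> {0..len' e}" "t \<in> {0..len' e}"
        have "f (\<phi> (edge_pt G' len' e t)) - f (\<phi> (edge_pt G' len' e s)) = of_int (k e) * (t - s)"
          using k st by (simp add: algebra_simps)
        then have "\<bar>f (\<phi> (edge_pt G' len' e t)) - f (\<phi> (edge_pt G' len' e s))\<bar> \<le> K * \<bar>t - s\<bar>"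
          using K(2)[OF st(1)] by (simp add: abs_mult mult_right_mono)
        then show "\<bar>f (\<phi> (edge_pt G' len' e t)) / K - f (\<phi> (edge_pt G' len' e s)) / K\<bar> \<le> \<bar>t - s\<bar>"
          using K(1) by (simp add: diff_divide_distrib[symmetric] divide_le_eq mult.commute)
      qed
      then show "\<bar>f (\<phi> y) - f (\<phi> x)\<bar> / K \<le> r" using K(1) by (simp add: diff_divide_distrib[symmetric])
    qed
    then show ?thesis using K(1) by (simp add: divide_le_eq mult.commute)
  qed
  have "\<bar>?F t - ?F s\<bar> \<le> K * \<bar>t - s\<bar>" if "s \<in> {0..len e}" "t \<in> {0..len e}" for s t
  proof -
    have pts: "edge_pt G len e s \<in> points G len" "edge_pt G len e t \<in> points G len"
      using edge_pt_in_points[OF w e] by auto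
    have "\<bar>?F t - ?F s\<bar> \<le> K * path_dist G len (edge_pt G len e s) (edge_pt G len e t)"
      using lip[OF \<psi>(1)[OF pts(1)] \<psi>(1)[OF pts(2)]] \<psi>(2)[OF pts(1)] \<psi>(2)[OF pts(2)] \<psi>_iso[OF pts] by simp
    also have "\<dots> \<le> K * \<bar>t - s\<bar>" using path_dist_edge_le[OF w e, of s len t] that K(1) by simp
    finally show ?thesis .
  qed
  then have "K-lipschitz_on {0..len e} ?F"
    using K(1) by (intro lipschitz_onI) (auto simp: dist_real_def abs_minus_commute)
  then show "continuous_on {0..len e} ?F" by (rule lipschitz_on_continuous_on)
  have pt: "Inner e t \<in> points G len" if "0 < t" "t < len e" for t using e that by (auto simp: points_def)
  have aff: "affine_at ?F t0" if t0: "0 < t0" "t0 < len e" and inner: "\<psi> (Inner e t0) = Inner e' a" for t0 e' a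
  proof -
    have x0: "Inner e' a \<in> points G' len'" using \<psi>(1)[OF pt[OF t0]] inner by simp
    then have e': "e' \<in> arcs G'" "0 < a" "a < len' e'" by (auto simp: points_def)
    \<comment> \<open>Points within \<open>d\<close> of \<open>t0\<close> are less than
      \<open>2 * d\<close> apart and more than \<open>2 * d\<close> from both ends of the edge, and
      so are their images; in this range distances can be read off the edge.\<close>
    define d where "d = Min {t0, len e - t0, a, len' e' - a} / 3"
    have d: "0 < d" "3 * d \<le> t0" "3 * d \<le> len e - t0" "3 * d \<le> a" "3 * d \<le> len' e' - a"
      using t0 e' by (auto simp: d_def)
    have "\<exists>u. \<psi> (Inner e t) = Inner e' u \<and> \<bar>u - a\<bar> = \<bar>t - t0\<bar>" if t: "\<bar>t - t0\<bar> < d" for t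
    proof -
      have t': "0 < t" "t < len e" using t d by auto
      have "path_dist G' len' (Inner e' a) (\<psi> (Inner e t)) = \<bar>t - t0\<bar>"
        using \<psi>_iso[OF pt[OF t0] pt[OF t']] near_Inner_dist[OF w con pos pt[OF t0] pt[OF t']] inner t d by auto
      moreover have "\<bar>t - t0\<bar> < min a (len' e' - a)" using t d by auto
      ultimately show ?thesis using near_Inner[OF w' con' pos' x0 \<psi>(1)[OF pt[OF t']]] by auto
    qed
    then obtain u where u: "\<And>t. \<bar>t - t0\<bar> < d \<Longrightarrow> \<psi> (Inner e t) = Inner e' (u t)"
      "\<And>t. \<bar>t - t0\<bar> < d \<Longrightarrow> \<bar>u t - a\<bar> = \<bar>t - t0\<bar>" by metis
    have "\<bar>u t - u s\<bar> = \<bar>t - s\<bar>" if s: "\<bar>s - t0\<bar> < d" and t: "\<bar>t - t0\<bar> < d" for s t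
    proof -
      have s': "0 < s" "s < len e" and t': "0 < t" "t < len e" using s t d by auto
      have us: "Inner e' (u s) \<in> points G' len'" "Inner e' (u t) \<in> points G' len'"
        using \<psi>(1)[OF pt[OF s']] \<psi>(1)[OF pt[OF t']] u(1)[OF s] u(1)[OF t] by auto
      have "\<bar>t - s\<bar> < min s (len e - s)" using s t d by linarith
      then have "path_dist G' len' (Inner e' (u s)) (Inner e' (u t)) = \<bar>t - s\<bar>"
        using \<psi>_iso[OF pt[OF s'] pt[OF t']] near_Inner_dist[OF w con pos pt[OF s'] pt[OF t']] u(1)[OF s] u(1)[OF t] by auto
      moreover have "\<bar>t - s\<bar> < min (u s) (len' e' - u s)" using s t d u(2)[OF s] by linarith
      ultimately show ?thesis using near_Inner[OF w' con' pos' us] by auto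
    qed
    then obtain \<sigma> where \<sigma>: "\<sigma> \<in> {1, -1}" "\<And>t. \<bar>t - t0\<bar> < d \<Longrightarrow> u t = u t0 + \<sigma> * (t - t0)"
      using real_local_isometry[OF d(1), of t0 u] by blast
    define m where "m = (if \<sigma> = 1 then k e' else - k e')"
    have ft: "?F t = c e' + of_int (k e') * u t" if t: "\<bar>t - t0\<bar> < d" for t
    proof -
      have t': "0 < t" "t < len e" using t d by auto
      have "\<bar>u t - a\<bar> < d" using u(2)[OF t] t by simp
      then have "0 < u t" "u t < len' e'" using d by auto
      then show ?thesis
        using k[OF e'(1), of "u t"] \<psi>(2)[OF pt[OF t']] u(1)[OF t] t' by (simp add: edge_pt_def)
    qed
    have "?F t = ?F t0 + of_int m * (t - t0)" if t: "\<bar>t - t0\<bar> < d" for t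
      using ft[OF t] ft[of t0] d(1) \<sigma>(1) \<sigma>(2)[OF t] by (auto simp: m_def algebra_simps)
    then have "\<forall>\<^sub>F t in nhds t0. ?F t = ?F t0 + of_int m * (t - t0)"
      using d(1) unfolding eventually_nhds_metric dist_real_def by blast
    then show ?thesis unfolding affine_at_def by blast
  qed
  have sub: "{t \<in> {0<..<len e}. \<not> affine_at ?F t} \<subseteq> (\<lambda>t. \<psi> (Inner e t)) -` (Vertex ` verts G') \<inter> {0<..<len e}"
  proof
    fix t assume "t \<in> {t \<in> {0<..<len e}. \<not> affine_at ?F t}"
    then have t: "t \<in> {0<..<len e}" "\<not> affine_at ?F t" by auto
    have "\<psi> (Inner e t) \<in> Vertex ` verts G'"
    proof (cases "\<psi> (Inner e t)")
      case (Vertex v)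
      then show ?thesis using \<psi>(1)[OF pt, of t] t by (auto simp: points_def)
    next
      case (Inner e' a)
      then show ?thesis using aff t by auto
    qed
    then show "t \<in> (\<lambda>t. \<psi> (Inner e t)) -` (Vertex ` verts G') \<inter> {0<..<len e}" using t(1) by simp
  qed
  have inj: "inj_on (\<lambda>t. \<psi> (Inner e t)) {0<..<len e}"
  proof (rule inj_onI)
    fix s t assume st: "s \<in> {0<..<len e}" "t \<in> {0<..<len e}" "\<psi> (Inner e s) = \<psi> (Inner e t)"
    have "\<phi> (\<psi> (Inner e s)) = Inner e s" "\<phi> (\<psi> (Inner e t)) = Inner e t"
      using st(1,2) by (auto intro!: \<psi>(2) pt)
    then show "s = t" using st(3) by (metis point.inject(2))
  qed
  have "finite ((\<lambda>t. \<psi> (Inner e t)) -` (Vertex ` verts G') \<inter> {0<..<len e})"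
    by (rule finite_vimage_IntI[OF _ inj]) (simp add: fin_digraph.finite_verts[OF fd'])
  then show "finite {t \<in> {0<..<len e}. \<not> affine_at ?F t}"
    by (rule finite_subset[OF sub])
qed

section \<open>Torsion points on an edge\<close>

text \<open>
  A power of a coset consists of sums of representatives, whether or not \<^const>\<open>principal\<close> is closed under
  addition. With \<open>h\<close> principal, \<open>h + n (h + x - q)\<close> is therefore principal, and so \<open>n (x - q)\<close> is the
  Laplacian of an integral combination of two functions that are piecewise linear on the edges of \<open>G\<close>.
\<close>

lemma torsion_slope_sum:
  assumes fd: "fin_digraph G" and con: "Digraph_Component.connected G" and pos: "\<forall>e\<in>arcs G. 0 < len e"
    and q: "q \<in> points G len" and x: "x \<in> points G len"
    and tors: "abel_jacobi G len q x \<in> torsion (Jac G len)" and ne: "principal G len \<noteq> {}"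
  shows "\<exists>f n. edgewise_PL G len f \<and> n > 0 \<and>
    (\<forall>z\<in>points G len. slope_sum G len f z = of_int n * (of_bool (z = q) - of_bool (z = x)))"
proof -
  define C where "C = abel_jacobi G len q x"
  obtain n :: nat where n: "n > 0" "C [^]\<^bsub>Jac G len\<^esub> n = \<one>\<^bsub>Jac G len\<^esub>"
    using tors by (auto simp: torsion_def C_def)
  obtain h where h: "h \<in> principal G len" using ne by blast
  have mult: "a \<otimes>\<^bsub>Div0 G len\<^esub> b = a + b" for a b by (simp add: Div0_def Div_def)
  have hC: "h + (frag_of x - frag_of q) \<in> C"
    using h by (auto simp: C_def abel_jacobi_def r_coset_def mult)
  have "h + frag_cmul (int m) (h + (frag_of x - frag_of q)) \<in> C [^]\<^bsub>Jac G len\<^esub> m" for m :: nat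
  proof (induction m)
    case 0
    then show ?case using h by (simp add: Jac_def FactGroup_def)
  next
    case (Suc m)
    have "h + frag_cmul (int (Suc m)) (h + (frag_of x - frag_of q)) =
      (h + frag_cmul (int m) (h + (frag_of x - frag_of q))) + (h + (frag_of x - frag_of q))"
      by (simp add: frag_cmul_distrib algebra_simps)
    moreover have "(h + frag_cmul (int m) (h + (frag_of x - frag_of q))) + (h + (frag_of x - frag_of q))
        \<in> (C [^]\<^bsub>Jac G len\<^esub> m) <#>\<^bsub>Div0 G len\<^esub> C"
      using Suc.IH hC unfolding set_mult_def mult by blast
    moreover have "C [^]\<^bsub>Jac G len\<^esub> Suc m = (C [^]\<^bsub>Jac G len\<^esub> m) <#>\<^bsub>Div0 G len\<^esub> C"
      by (simp add: Jac_def FactGroup_def)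
    ultimately show ?case by (simp only:)
  qed
  from this[of n] have mem: "h + frag_cmul (int n) (h + (frag_of x - frag_of q)) \<in> principal G len"
    using n(2) by (simp add: Jac_def FactGroup_def)
  obtain f0 where f0: "f0 \<in> PL_int G len" "h = Laplacian G len f0" using h by (auto simp: principal_def)
  obtain f1 where f1: "f1 \<in> PL_int G len"
    "h + frag_cmul (int n) (h + (frag_of x - frag_of q)) = Laplacian G len f1"
    using mem by (auto simp: principal_def)
  have PL: "edgewise_PL G len f0" "edgewise_PL G len f1"
    using PL_int_edgewise[OF fd con pos] f0 f1 by auto
  \<comment> \<open>Subtracting \<open>1 + n\<close> copies of \<open>f0\<close> removes
    \<open>h\<close>. Slope sums have the sign opposite to the divisor, so \<open>q\<close> gets the
    coefficient \<open>n\<close>.\<close>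
  define f where "f = (\<lambda>x. of_int 1 * f1 x + of_int (- (1 + int n)) * f0 x)"
  have "slope_sum G len f z = of_int (int n) * (of_bool (z = q) - of_bool (z = x))" if z: "z \<in> points G len" for z
  proof -
    have "Poly_Mapping.lookup (Laplacian G len f1) z =
      (1 + int n) * Poly_Mapping.lookup (Laplacian G len f0) z + int n * (of_bool (z = x) - of_bool (z = q))"
      unfolding f1(2)[symmetric] f0(2)[symmetric]
      by (auto simp: lookup_add lookup_minus lookup_frag_cmul lookup_single when_def algebra_simps)
    then have "real_of_int (Poly_Mapping.lookup (Laplacian G len f1) z) =
      (1 + real n) * of_int (Poly_Mapping.lookup (Laplacian G len f0) z) + real n * (of_bool (z = x) - of_bool (z = q))"
      by simp
    then have "- slope_sum G len f1 z = (1 + real n) * (- slope_sum G len f0 z) + real n * (of_bool (z = x) - of_bool (z = q))"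
      unfolding lookup_Laplacian[OF fd PL(1) z] lookup_Laplacian[OF fd PL(2) z] .
    moreover have "slope_sum G len f z = of_int 1 * slope_sum G len f1 z + of_int (- (1 + int n)) * slope_sum G len f0 z"
      unfolding f_def by (rule slope_sum_combine[OF PL(2,1)])
    ultimately show ?thesis by (simp add: algebra_simps)
  qed
  moreover have "edgewise_PL G len f" unfolding f_def by (rule edgewise_PL_combine[OF PL(2,1)])
  ultimately show ?thesis using n(1) by (intro exI[of _ f] exI[of _ "int n"]) auto
qed

text \<open>At the bend \<open>t = a\<close> the function rises to the right and is flat to the
  left, hence the different inequalities.\<close>

lemma dir_slope_hinge:
  "dir_slope (\<lambda>s. max 0 (s - a)) t 1 (of_bool (a \<le> t))"
  "dir_slope (\<lambda>s. max 0 (s - a)) t (-1) (- of_bool (a < t))"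
proof -
  show "dir_slope (\<lambda>s. max 0 (s - a)) t 1 (of_bool (a \<le> t))"
  proof (cases "a \<le> t")
    case True
    then show ?thesis by (intro dir_slope_right[of t "t + 1" _ "-a"]) auto
  next
    case False
    then show ?thesis by (intro dir_slope_right[of t a _ 0]) auto
  qed
  show "dir_slope (\<lambda>s. max 0 (s - a)) t (-1) (- of_bool (a < t))"
  proof (cases "a < t")
    case True
    then show ?thesis by (intro dir_slope_left[of a t _ "-a"]) auto
  next
    case False
    then show ?thesis by (intro dir_slope_left[of "t - 1" t _ 0]) auto
  qed
qed

text \<open>The slopes \<open>k\<close> of the straightened function are those of \<open>f\<close>
  near both ends of every edge. As slope sums vanish at the vertices, \<open>k\<close> is a
  conserved flow, to which \<open>no_flow\<close> applies.\<close>

lemma no_torsion_along_edge: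
  fixes G :: "('v, 'e) pre_digraph"
  assumes fd: "fin_digraph G" and bic: "biconnected G" and gen: "2 \<le> genus G"
    and pos: "\<forall>e\<in>arcs G. 0 < len e"
    and indep: "\<And>m :: 'e \<Rightarrow> int. (\<Sum>a\<in>arcs G. of_int (m a) * len a) = 0 \<Longrightarrow> \<forall>a\<in>arcs G. m a = 0"
    and e: "e \<in> arcs G" and ab: "0 < a" "a < b" "b < len e"
    and PL: "edgewise_PL G len f"
    and slopes: "\<And>z. z \<in> points G len \<Longrightarrow>
      slope_sum G len f z = of_int N * (of_bool (z = Inner e a) - of_bool (z = Inner e b))"
  shows "N = 0"
proof -
  interpret fin_digraph G by (rule fd)
  \<comment> \<open>adding \<open>w\<close> straightens out the bends of \<open>f\<close> at the two points\<close>
  define w where "w = (\<lambda>s. real_of_int N * max 0 (s - b) + (- real_of_int N) * max 0 (s - a))"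
  define F where "F = (\<lambda>d t. f (edge_pt G len d t))"
  define g where "g = (\<lambda>d s. 1 * F d s + (if d = e then 1 else 0) * w s)"
  have "\<exists>k::int. \<forall>s\<in>{0..len d}. g d s = g d 0 + of_int k * (s - 0)" if d: "d \<in> arcs G" for d
  proof (rule affine_on_interval)
    show "0 < len d" using pos d by blast
    have "continuous_on {0..len d} (F d)" using PL d by (auto simp: edgewise_PL_def F_def)
    then show "continuous_on {0..len d} (g d)" unfolding g_def w_def by (intro continuous_intros)
    fix t assume t: "0 < t" "t < len d"
    obtain r l :: int where r: "dir_slope (F d) t 1 (of_int r)" and l: "dir_slope (F d) t (-1) (of_int l)"
      using edgewise_PL_dir_slope[OF PL d, of 1 t] edgewise_PL_dir_slope[OF PL d, of "-1" t] t
      unfolding F_def by auto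
    have "slope_sum G len f (Inner d t) = of_int r + of_int l"
      by (rule slope_sum_Inner[OF d t r[unfolded F_def] l[unfolded F_def]])
    then have rl: "real_of_int r + of_int l = of_int N * (of_bool (d = e \<and> t = a) - of_bool (d = e \<and> t = b))"
      using slopes[of "Inner d t"] d t by (simp add: points_def)
    have wr: "dir_slope w t 1 (of_int N * of_bool (b \<le> t) + (- of_int N) * of_bool (a \<le> t))"
      unfolding w_def by (rule dir_slope_combine[OF dir_slope_hinge(1) dir_slope_hinge(1)])
    have wl: "dir_slope w t (-1) (of_int N * - of_bool (b < t) + (- of_int N) * - of_bool (a < t))"
      unfolding w_def by (rule dir_slope_combine[OF dir_slope_hinge(2) dir_slope_hinge(2)])
    note gr = dir_slope_combine[OF r wr, of 1 "if d = e then 1 else 0"]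
    note gl = dir_slope_combine[OF l wl, of 1 "if d = e then 1 else 0"]
    show "affine_at (g d) t"
    proof (rule affine_atI)
      let ?k = "1 * of_int r + (if d = e then 1 else 0) *
        (of_int N * of_bool (b \<le> t) + (- of_int N) * of_bool (a \<le> t)) :: real"
      show "dir_slope (g d) t 1 ?k" unfolding g_def by (rule gr)
      \<comment> \<open>On \<open>e\<close>, the slope of \<open>f\<close> jumps by \<open>N\<close>
        at \<open>a\<close> and by \<open>-N\<close> at \<open>b\<close>; the slope of
        \<open>w\<close> jumps by the opposite amounts.\<close>
      have "- ?k = 1 * of_int l + (if d = e then 1 else 0) *
        (of_int N * - of_bool (b < t) + (- of_int N) * - of_bool (a < t))"
        using rl ab by (cases "d = e"; cases t a rule: linorder_cases; cases t b rule: linorder_cases) (auto simp: algebra_simps)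
      then show "dir_slope (g d) t (-1) (- ?k)" using gl unfolding g_def by simp
      show "?k \<in> \<int>" by auto
    qed
  qed
  then obtain k :: "'e \<Rightarrow> int" where k: "\<And>d s. d \<in> arcs G \<Longrightarrow> s \<in> {0..len d} \<Longrightarrow> g d s = g d 0 + of_int (k d) * s"
    by (metis diff_zero)
  have w0: "w s = 0" if "s \<le> a" for s using that ab by (simp add: w_def)
  have w1: "w s = of_int N * (a - b)" if "b \<le> s" for s using that ab by (simp add: w_def algebra_simps)
  have Fg: "F d s = g d s - (if d = e then w s else 0)" for d s by (simp add: g_def)
  have F0: "F d 0 = f (Vertex (tail G d))" for d by (simp add: F_def edge_pt_def)
  have F1: "F d (len d) = f (Vertex (head G d))" if "d \<in> arcs G" for d
    using pos that by (auto simp: F_def edge_pt_def)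
  have out: "dir_slope (F d) 0 1 (of_int (k d))" if d: "d \<in> arcs G" for d
  proof (rule dir_slope_right)
    \<comment> \<open>\<open>w\<close> vanishes up to \<open>a\<close>, so \<open>F\<close> still
      has the slope of \<open>g\<close> there.\<close>
    define \<beta> where "\<beta> = (if d = e then a else len d)"
    show "0 < \<beta>" using pos d ab by (simp add: \<beta>_def)
    fix s assume "s \<in> {0..\<beta>}"
    then show "F d s = g d 0 + of_int (k d) * s"
      using k[OF d, of s] ab w0[of s] unfolding Fg by (auto simp: \<beta>_def split: if_splits)
  qed
  have inn: "dir_slope (F d) (len d) (-1) (- of_int (k d))" if d: "d \<in> arcs G" for d
  proof (rule dir_slope_left)
    define \<alpha> where "\<alpha> = (if d = e then b else 0)"
    show "\<alpha> < len d" using pos d ab by (simp add: \<alpha>_def)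
    fix s assume "s \<in> {\<alpha>..len d}"
    then show "F d s = (g d 0 - (if d = e then of_int N * (a - b) else 0)) + of_int (k d) * s"
      using k[OF d, of s] ab w1[of s] unfolding Fg by (auto simp: \<alpha>_def split: if_splits)
  qed
  have conserved: "(\<Sum>d\<in>in_arcs G v. k d) = (\<Sum>d\<in>out_arcs G v. k d)" if v: "v \<in> verts G" for v
  proof -
    have "slope_sum G len f (Vertex v) = (\<Sum>d\<in>out_arcs G v. of_int (k d)) + (\<Sum>d\<in>in_arcs G v. - of_int (k d))"
    proof (rule slope_sum_Vertex[OF fd])
      show "0 < len d" if "d \<in> arcs G" for d using pos that by blast
      show "dir_slope (\<lambda>t. f (edge_pt G len d t)) 0 1 (of_int (k d))" if "d \<in> out_arcs G v" for d
        using out[of d] that by (simp add: out_arcs_def F_def)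
      show "dir_slope (\<lambda>t. f (edge_pt G len d t)) (len d) (-1) (- of_int (k d))" if "d \<in> in_arcs G v" for d
        using inn[of d] that by (simp add: in_arcs_def F_def)
    qed
    moreover have "slope_sum G len f (Vertex v) = 0" using slopes[of "Vertex v"] v by (simp add: points_def)
    ultimately have "(\<Sum>d\<in>out_arcs G v. real_of_int (k d)) = (\<Sum>d\<in>in_arcs G v. real_of_int (k d))"
      by (simp add: sum_negf)
    then show ?thesis by (metis of_int_eq_iff of_int_sum)
  qed
  interpret resonant_flow G len "\<lambda>v. f (Vertex v)" k e
  proof
    show "m d = 0" if "(\<Sum>a\<in>arcs G. of_int (m a) * len a) = 0" "d \<in> arcs G" for m :: "'e \<Rightarrow> int" and d
      using indep that by blast
    show "f (Vertex (head G d)) - f (Vertex (tail G d)) = of_int (k d) * len d" if "d \<in> arcs G" "d \<noteq> e" for d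
      using k[of d "len d"] that pos F0[of d] F1[of d] Fg[of d 0] Fg[of d "len d"] by auto
  qed (use e pos bic gen conserved in auto)
  \<comment> \<open>Both \<open>g\<close> and \<open>f\<close> take equal values at the two ends of
    \<open>e\<close>, hence so does \<open>w\<close>, which changes by
    \<open>N * (a - b)\<close>.\<close>
  have "g e (len e) = g e 0" "F e (len e) = F e 0"
    using no_flow k[OF e, of "len e"] ab F0 F1[OF e] by auto
  then have "of_int N * (a - b) = 0"
    using Fg[of e 0] Fg[of e "len e"] w0[of 0] w1[of "len e"] ab by simp
  then show ?thesis using ab by simp
qed

section \<open>At most one torsion point in the interior of each edge\<close>

lemma manin_mumford_if_lengths_independent:
  fixes G :: "('v, 'e) pre_digraph"
  assumes fd: "fin_digraph G" and con: "Digraph_Component.connected G" and bic: "biconnected G" and gen: "2 \<le> genus G"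
    and pos: "\<forall>e\<in>arcs G. 0 < len e"
    and indep: "\<And>m :: 'e \<Rightarrow> int. (\<Sum>a\<in>arcs G. of_int (m a) * len a) = 0 \<Longrightarrow> \<forall>a\<in>arcs G. m a = 0"
  shows "manin_mumford G len"
  unfolding manin_mumford_def
proof
  fix q assume q: "q \<in> points G len"
  define X where "X = {x \<in> points G len. abel_jacobi G len q x \<in> torsion (Jac G len)}"
  show "finite (abel_jacobi G len q ` points G len \<inter> torsion (Jac G len))"
  proof (cases "principal G len = {}")
    \<comment> \<open>Cosets of the empty set are empty, so the image has at most one
      element.\<close>
    case True
    then have "abel_jacobi G len q ` points G len \<subseteq> {{}}" by (auto simp: abel_jacobi_def r_coset_def)
    then show ?thesis by (meson finite.emptyI finite.insertI finite_Int finite_subset)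
  next
    case ne: False
    have no_pair: False if e: "e \<in> arcs G" and X: "Inner e a \<in> X" "Inner e b \<in> X" and ab: "a < b" for e a b
    proof -
      have pts: "Inner e a \<in> points G len" "Inner e b \<in> points G len" using X by (auto simp: X_def)
      obtain f n where f: "edgewise_PL G len f" "n > 0"
        "\<And>z. z \<in> points G len \<Longrightarrow> slope_sum G len f z = of_int n * (of_bool (z = q) - of_bool (z = Inner e a))"
        using torsion_slope_sum[OF fd con pos q pts(1) _ ne] X by (auto simp: X_def)
      obtain g m where g: "edgewise_PL G len g" "m > 0"
        "\<And>z. z \<in> points G len \<Longrightarrow> slope_sum G len g z = of_int m * (of_bool (z = q) - of_bool (z = Inner e b))"
        using torsion_slope_sum[OF fd con pos q pts(2) _ ne] X by (auto simp: X_def)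
      \<comment> \<open>In \<open>n * g - m * f\<close> the contributions of \<open>q\<close>
        cancel, which leaves \<open>n * m\<close> times the difference of the two points.\<close>
      have "n * m = 0"
      proof (rule no_torsion_along_edge[OF fd bic gen pos indep e _ ab _ edgewise_PL_combine[OF g(1) f(1), of n "-m"]])
        fix z assume z: "z \<in> points G len"
        show "slope_sum G len (\<lambda>x. of_int n * g x + of_int (- m) * f x) z =
            of_int (n * m) * (of_bool (z = Inner e a) - of_bool (z = Inner e b))"
          unfolding slope_sum_combine[OF g(1) f(1)] f(3)[OF z] g(3)[OF z] by (simp add: algebra_simps)
      qed (use pts in \<open>auto simp: points_def\<close>)
      then show False using f(2) g(2) by simp
    qed
    have "finite {t. Inner e t \<in> X}" if e: "e \<in> arcs G" for e
    proof -
      have "\<exists>c. {t. Inner e t \<in> X} \<subseteq> {c}"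
        using no_pair[OF e] by (metis linorder_neqE mem_Collect_eq singletonI subsetI)
      then show ?thesis using finite_subset by blast
    qed
    then have "finite (Vertex ` verts G \<union> (\<Union>e\<in>arcs G. Inner e ` {t. Inner e t \<in> X}))"
      using fin_digraph.finite_verts[OF fd] fin_digraph.finite_arcs[OF fd] by auto
    moreover have "X \<subseteq> Vertex ` verts G \<union> (\<Union>e\<in>arcs G. Inner e ` {t. Inner e t \<in> X})"
      by (auto simp: X_def points_def)
    ultimately have "finite (abel_jacobi G len q ` X)" using finite_subset by blast
    moreover have "abel_jacobi G len q ` points G len \<inter> torsion (Jac G len) \<subseteq> abel_jacobi G len q ` X"
      by (auto simp: X_def)
    ultimately show ?thesis by (rule rev_finite_subset)
  qed
qed

section \<open>Very general lengths\<close>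

text \<open>The inner \<open>single e 1\<close> is the exponent vector of the variable of
  \<open>e\<close>. Integral coefficients keep the family of forms countable.\<close>

definition linear_form :: "'e set \<Rightarrow> ('e \<Rightarrow> int) \<Rightarrow> ('e \<Rightarrow>\<^sub>0 nat) \<Rightarrow>\<^sub>0 real" where
  "linear_form E m = (\<Sum>e\<in>E. Poly_Mapping.single (Poly_Mapping.single e 1) (of_int (m e)))"

lemma single_one_eq_iff: "Poly_Mapping.single e (Suc 0) = Poly_Mapping.single e' (Suc 0) \<longleftrightarrow> e = e'"
  by (metis keys_single nat.distinct(1) singleton_insert_inj_eq)

lemma lookup_linear_form:
  assumes "finite E" "e \<in> E"
  shows "Poly_Mapping.lookup (linear_form E m) (Poly_Mapping.single e (Suc 0)) = of_int (m e)"
  using assms by (simp add: linear_form_def lookup_sum lookup_single when_def single_one_eq_iff)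

lemma keys_linear_form:
  "Poly_Mapping.keys (linear_form E m) \<subseteq> (\<lambda>e. Poly_Mapping.single e 1) ` E"
  unfolding linear_form_def by (rule order_trans[OF keys_sum]) auto

lemma poly_eval_linear_form:
  assumes "finite E"
  shows "poly_eval (linear_form E m) len = (\<Sum>e\<in>E. of_int (m e) * len e)"
proof -
  let ?t = "\<lambda>x. Poly_Mapping.lookup (linear_form E m) x * (\<Prod>e\<in>Poly_Mapping.keys x. len e ^ Poly_Mapping.lookup x e)"
  \<comment> \<open>Variables with coefficient 0 are not among the keys, but their terms
    vanish.\<close>
  have "poly_eval (linear_form E m) len = (\<Sum>x\<in>(\<lambda>e. Poly_Mapping.single e 1) ` E. ?t x)"
    unfolding poly_eval_def using assms keys_linear_form
    by (intro sum.mono_neutral_left) (auto simp: in_keys_iff)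
  also have "\<dots> = (\<Sum>e\<in>E. ?t (Poly_Mapping.single e 1))"
    by (subst sum.reindex) (auto simp: inj_on_def single_one_eq_iff)
  also have "\<dots> = (\<Sum>e\<in>E. of_int (m e) * len e)"
    using assms by (intro sum.cong refl) (simp add: lookup_linear_form)
  finally show ?thesis .
qed

theorem theorem1p3:
  fixes G :: "('v, 'e) pre_digraph"
  assumes "fin_digraph G"
    and "Digraph_Component.connected G"
    and "genus G \<ge> 2"
    and "biconnected G"
  shows "very_general_lengths G (\<lambda>len. manin_mumford G len)"
proof -
  have fin: "finite (arcs G)" by (rule fin_digraph.finite_arcs[OF assms(1)])
  \<comment> \<open>Extensional functions on the finite set of edges are countably many; a nonzero
    value on some edge makes the form a nonzero polynomial. Avoiding all zeros is rational
    independence of the lengths.\<close>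
  define M where "M = {m \<in> arcs G \<rightarrow>\<^sub>E (UNIV :: int set). \<exists>e\<in>arcs G. m e \<noteq> 0}"
  have "countable (linear_form (arcs G) ` M)"
    unfolding M_def by (intro countable_image countable_Collect countable_PiE fin) auto
  moreover have "p \<noteq> 0 \<and> poly_vars p \<subseteq> arcs G" if p: "p \<in> linear_form (arcs G) ` M" for p
  proof -
    obtain m e where m: "p = linear_form (arcs G) m" "e \<in> arcs G" "m e \<noteq> 0" using p by (auto simp: M_def)
    then have "p \<noteq> 0" using lookup_linear_form[OF fin m(2), of m] by auto
    moreover have "poly_vars p \<subseteq> arcs G" using keys_linear_form[of "arcs G" m] m(1) by (force simp: poly_vars_def)
    ultimately show ?thesis ..
  qed
  moreover have "manin_mumford G len"
    if pos: "\<forall>e\<in>arcs G. 0 < len e" and nz: "\<forall>p\<in>linear_form (arcs G) ` M. poly_eval p len \<noteq> 0" for len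
  proof (rule manin_mumford_if_lengths_independent[OF assms(1,2,4,3) pos])
    fix m :: "'e \<Rightarrow> int" assume 0: "(\<Sum>a\<in>arcs G. of_int (m a) * len a) = 0"
    \<comment> \<open>Restriction makes \<open>m\<close> extensional without changing the
      sum.\<close>
    then have "poly_eval (linear_form (arcs G) (restrict m (arcs G))) len = 0"
      by (simp add: poly_eval_linear_form[OF fin])
    then have "restrict m (arcs G) \<notin> M" using nz by blast
    then show "\<forall>a\<in>arcs G. m a = 0" by (auto simp: M_def)
  qed
  ultimately show ?thesis
    unfolding very_general_lengths_def by (intro exI[of _ "linear_form (arcs G) ` M"] conjI allI impI) blast+
qed

end
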